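(* Let $\Lambda=\{\lambda_n\}_{n=1}^{\infty}\subset\mathbb{N}$ be a strictly increasing sequence of positive integers with $\sum_{n=1}^{\infty}\frac{1}{\lambda_n}<\infty$. Let $r_{\Lambda}=\{r_n\}_{n=1}^{\infty}\subset\overline{M_{\Lambda}}$ be the unique family in $\overline{M_{\Lambda}}$ biorthogonal to the system $M_{\Lambda}=\{t^{\lambda_n}\}_{n=1}^{\infty}$ in $L^2(0,1)$. Then $$H^2(\mathbb{D},\Lambda)=\overline{M^2_{\Lambda}}(\mathbb{D}).$$ Moreover, for every $f\in H^2(\mathbb{D},\Lambda)$, $$\|f\|_{H^2}^2=\sum_{n=1}^{\infty}\left|\langle f,r_n\rangle_{L^2(0,1)}\right|^2.$$ In addition, for every $f\in H^2(\mathbb{D},\Lambda)$ with Fourier (equivalently Taylor) coefficients $c_{\lambda_n}$, i.e. $f(z)=\sum_{n=1}^{\infty}c_{\lambda_n}z^{\lambda_n}$, and for every fixed $\theta\in[0,2\pi]$, $$c_{\lambda_n}=\left(\int_0^1 f(te^{i\theta})\,\overline{r_n(t)}\,dt\right)e^{-i\theta\lambda_n},\qquad n=1,2,\dots$$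
   Context: $\mathbb{D}=\{z\in\mathbb{C}:|z|<1\}$. $L^2(0,1)$ is the space of complex-valued square-integrable functions for Lebesgue measure, with inner product $\langle f,g\rangle_{L^2(0,1)}=\int_0^1 f(t)\overline{g(t)}\,dt$. For a function $f$ analytic on $\mathbb{D}$, $\langle f,r_n\rangle_{L^2(0,1)}$ refers to the restriction of $f$ to $[0,1)$. Hardy space: $H^2(\mathbb{D})$ is the set of analytic functions $f(z)=\sum_{n=0}^\infty a_nz^n$ on $\mathbb{D}$ with $\sup_{0<r<1}\int_0^{2\pi}|f(re^{i\theta})|^2\,d\theta<\infty$, equivalently $\sum_{n=0}^\infty|a_n|^2<\infty$; its norm is $\|f\|_{H^2}=\left(\sum_{n=0}^\infty|a_n|^2\right)^{1/2}$. The Taylor coefficients $a_n$ equal the Fourier coefficients $c_n=\frac1{2\pi}\int_0^{2\pi}f(e^{i\theta})e^{-in\theta}\,d\theta$ of the boundary function of $f$. $H^2(\mathbb{D},\Lambda)$ is the set of $f\in H^2(\mathbb{D})$ whose Fourier coefficients vanish at all $n\notin\Lambda$; that is, the analytic functions on $\mathbb{D}$ of the form $f(z)=\sum_{n=1}^\infty c_{\lambda_n}z^{\lambda_n}$ with $\{c_{\lambda_n}\}\in\ell^2$. $M_\Lambda$ denotes the system $\{e_n\}_{n=1}^\infty$, $e_n(t)=t^{\lambda_n}$, and $\overline{M_\Lambda}$ its closed linear span in $L^2(0,1)$. Since $\sum 1/\lambda_n<\infty$, by the Clarkson–Erdős theorem every $f\in\overline{M_\Lambda}$ extends analytically to $\mathbb{D}$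 (i.e. agrees a.e. on $(0,1)$ with a function analytic on $\mathbb{D}$), the extension having a power series of the form $f(z)=\sum_{n=1}^\infty a_{\lambda_n}z^{\lambda_n}$. The set of these analytic extensions is denoted $\overline{M_\Lambda}(\mathbb{D})$. The system $M_\Lambda$ is minimal (no element lies in the closed span of the others), and there is a unique family $\{r_n\}_{n=1}^\infty\subset\overline{M_\Lambda}$ with $\langle e_n,r_m\rangle_{L^2(0,1)}=1$ if $m=n$ and $0$ if $m\neq n$; this is the biorthogonal family. $\overline{M^2_\Lambda}(\mathbb{D})=\left\{f\in\overline{M_\Lambda}(\mathbb{D}):\ \{\langle f,r_n\rangle_{L^2(0,1)}\}_{n=1}^\infty\in\ell^2\right\}$. *)

theory Defs
  imports "HOL-Complex_Analysis.Complex_Analysis"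
begin

text \<open>Conventions. Elements of \<open>L\<^sup>2(0,1)\<close> are represented by functions (not by classes modulo
  a.e. equality). Functions on the unit disc \<open>ball 0 1\<close> are represented by total functions
  \<open>complex \<Rightarrow> complex\<close>; every predicate below depends only on the values in the disc, so
  equality of two such sets is equality of the sets of functions on the disc. Sequences
  \<open>(\<lambda>\<^sub>n)\<close>, \<open>n \<ge> 1\<close>, are indexed from \<open>0\<close>, i.e. \<open>lam n\<close> is \<open>\<lambda>\<^sub>n\<^sub>+\<^sub>1\<close>.\<close>

section \<open>The space \<open>L\<^sup>2(0,1)\<close>\<close>

definition L2_space :: "(real \<Rightarrow> complex) set" where
  "L2_space = {f \<in> borel_measurable (lebesgue_on {0<..<1}).
     integrable (lebesgue_on {0<..<1}) (\<lambda>t. (cmod (f t))\<^sup>2)}"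

definition L2_inner :: "(real \<Rightarrow> complex) \<Rightarrow> (real \<Rightarrow> complex) \<Rightarrow> complex" where
  "L2_inner f g = (LINT t|lebesgue_on {0<..<1}. f t * cnj (g t))"

definition L2_norm :: "(real \<Rightarrow> complex) \<Rightarrow> real" where
  "L2_norm f = sqrt (LINT t|lebesgue_on {0<..<1}. (cmod (f t))\<^sup>2)"

text \<open>Finite linear combinations of \<open>e\<close> are written over initial segments, with zero
  coefficients allowed. The family \<open>e\<close> is meant to lie in \<^const>\<open>L2_space\<close>.\<close>

definition L2_closed_span :: "(nat \<Rightarrow> real \<Rightarrow> complex) \<Rightarrow> (real \<Rightarrow> complex) set" where
  "L2_closed_span e = {f \<in> L2_space.
     \<forall>\<epsilon>>0. \<exists>N a. L2_norm (\<lambda>t. f t - (\<Sum>n<N. a n * e n t)) < \<epsilon>}"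

section \<open>The Muentz system and its biorthogonal family\<close>

definition muentz_system :: "(nat \<Rightarrow> nat) \<Rightarrow> nat \<Rightarrow> real \<Rightarrow> complex" where
  "muentz_system lam n t = complex_of_real t ^ lam n"

definition muentz_closure :: "(nat \<Rightarrow> nat) \<Rightarrow> (real \<Rightarrow> complex) set" where
  "muentz_closure lam = L2_closed_span (muentz_system lam)"

text \<open>Such a family is unique only up to a.e. equality, so it is a predicate on representatives.\<close>

definition biorthogonal_family :: "(nat \<Rightarrow> nat) \<Rightarrow> (nat \<Rightarrow> real \<Rightarrow> complex) \<Rightarrow> bool" where
  "biorthogonal_family lam r \<longleftrightarrow>
     (\<forall>n. r n \<in> muentz_closure lam) \<and>
     (\<forall>m n. L2_inner (muentz_system lam n) (r m) = (if m = n then 1 else 0))"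

text \<open>The analytic extensions to the disc of the elements of the closed span. That their power
  series only involve exponents in \<open>range lam\<close> is the Clarkson-Erdos theorem; it is not made
  part of the definition.\<close>

definition muentz_disc :: "(nat \<Rightarrow> nat) \<Rightarrow> (complex \<Rightarrow> complex) set" where
  "muentz_disc lam = {F. F holomorphic_on ball 0 1 \<and>
     (\<exists>f \<in> muentz_closure lam. AE t in lebesgue_on {0<..<1}. F (complex_of_real t) = f t)}"

definition muentz_disc_l2 ::
  "(nat \<Rightarrow> nat) \<Rightarrow> (nat \<Rightarrow> real \<Rightarrow> complex) \<Rightarrow> (complex \<Rightarrow> complex) set" where
  "muentz_disc_l2 lam r = {F \<in> muentz_disc lam.
     summable (\<lambda>n. (cmod (L2_inner (\<lambda>t. F (complex_of_real t)) (r n)))\<^sup>2)}"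

section \<open>Hardy spaces\<close>

definition hardy2 :: "(complex \<Rightarrow> complex) set" where
  "hardy2 = {f. f holomorphic_on ball 0 1 \<and>
     bdd_above ((\<lambda>\<rho>. integral {0..2*pi} (\<lambda>\<theta>. (cmod (f (complex_of_real \<rho> * cis \<theta>)))\<^sup>2)) ` {0<..<1})}"

definition taylor_coeff :: "(complex \<Rightarrow> complex) \<Rightarrow> nat \<Rightarrow> complex" where
  "taylor_coeff f n = fps_nth (fps_expansion f 0) n"

definition hardy2_norm :: "(complex \<Rightarrow> complex) \<Rightarrow> real" where
  "hardy2_norm f = sqrt (\<Sum>n. (cmod (taylor_coeff f n))\<^sup>2)"

text \<open>For \<open>f\<close> in \<^const>\<open>hardy2\<close> the Fourier coefficients of the boundary function are the Taylor
  coefficients (and vanish at negative indices).\<close>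

definition hardy2_spectrum :: "(nat \<Rightarrow> nat) \<Rightarrow> (complex \<Rightarrow> complex) set" where
  "hardy2_spectrum lam = {f \<in> hardy2. \<forall>n. n \<notin> range lam \<longrightarrow> taylor_coeff f n = 0}"

end

theory Submission
  imports Defs
begin

text \<open>On \<open>L\<^sup>2(0,1)\<close> the map multiplying the coefficient of \<open>t\<^sup>l\<close> in a polynomial by the
  Blaschke factor \<open>(l - m) / (l + m + 1)\<close> is a contraction: the Gram matrix \<open>1 / (j + k + 1)\<close>
  loses a positive rank one matrix. Composing these maps over all exponents but \<open>\<lambda>\<^sub>n\<close> isolates
  the coefficient \<open>a\<^sub>n\<close> and gives \<open>|a\<^sub>n| \<le> R ^ \<lambda>\<^sub>n \<parallel>P\<parallel>\<close> for Muentz polynomials \<open>P\<close>, with \<open>R\<close>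
  depending only on \<open>\<Lambda>\<close>. If Muentz polynomials converge to \<open>F\<close> in \<open>L\<^sup>2(0,1)\<close>, their coefficients
  converge to \<open>\<langle>F, r\<^sub>n\<rangle>\<close>, so by dominated convergence \<open>F = \<Sum>\<langle>F, r\<^sub>n\<rangle> t\<^bsup>\<lambda>\<^sub>n\<^esup>\<close> on \<open>(0, 1/R)\<close>; since
  \<open>F\<close> is given as a holomorphic function on the disc, this small interval determines its Taylor
  coefficients. Conversely, for square summable \<open>c\<close> the series \<open>\<Sum>c\<^sub>n t\<^bsup>\<lambda>\<^sub>n\<^esup>\<close> converges in
  \<open>L\<^sup>2(0,1)\<close> because \<open>\<Sum>\<parallel>t\<^bsup>\<lambda>\<^sub>n\<^esup>\<parallel>\<^sup>2 \<le> \<Sum>1/\<lambda>\<^sub>n\<close>.\<close>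

section \<open>A coefficient bound for the quadratic form of the Cauchy matrix\<close>

text \<open>The Gram form of the monomials with exponents \<open>l k\<close> in L2(0,1), since
  \<open>1 / (l j + l k + 1)\<close> is the inner product of two of them;
  \<open>L2_norm_muentz_poly\<close> makes this identification.\<close>

definition cauchy_form :: "'i set \<Rightarrow> ('i \<Rightarrow> nat) \<Rightarrow> ('i \<Rightarrow> complex) \<Rightarrow> complex" where
  "cauchy_form A l a = (\<Sum>j\<in>A. \<Sum>k\<in>A. a j * cnj (a k) / of_nat (l j + l k + 1))"

text \<open>In the variable s = l + 1/2 this is the Blaschke factor of the right half plane with
  zero at m + 1/2.\<close>

definition blaschke_factor :: "nat \<Rightarrow> nat \<Rightarrow> real" where
  "blaschke_factor m l = (real l - real m) / (real l + real m + 1)"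

text \<open>Comes from (l + m + 1)(n + m + 1) - (l - m)(n - m) = (2m + 1)(l + n + 1). The factor l +
  n + 1 cancels, and a kernel of rank one in l and n is left.\<close>

lemma blaschke_kernel_identity:
  "1 / (real l + real n + 1) - blaschke_factor m l * blaschke_factor m n / (real l + real n + 1) =
     (2 * real m + 1) / ((real l + real m + 1) * (real n + real m + 1))"
proof -
  have nz: "real l + real n + 1 \<noteq> 0" "real l + real m + 1 \<noteq> 0" "real n + real m + 1 \<noteq> 0"
    by linarith+
  show ?thesis
    unfolding blaschke_factor_def using nz
    by (simp add: divide_simps) (simp add: algebra_simps)
qed

text \<open>The rank one kernel turns the double sum into the square modulus of a single linear
  functional, namely the pairing of the polynomial with coefficients \<open>a\<close> against t^m in
  L2(0,1).\<close>

lemma cauchy_form_blaschke_diff: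
  "cauchy_form A l a - cauchy_form A l (\<lambda>k. a k * of_real (blaschke_factor m (l k))) =
     of_real ((2 * real m + 1) * (cmod (\<Sum>k\<in>A. a k / of_nat (l k + m + 1)))\<^sup>2)"
proof -
  have *: "a j * cnj (a k) / of_nat (l j + l k + 1) -
      a j * of_real (blaschke_factor m (l j)) * cnj (a k * of_real (blaschke_factor m (l k)))
        / of_nat (l j + l k + 1) =
     of_real (2 * real m + 1) * (a j / of_nat (l j + m + 1) * cnj (a k / of_nat (l k + m + 1)))"
    for j k
  proof -
    have "a j * cnj (a k) / of_nat (l j + l k + 1) -
      a j * of_real (blaschke_factor m (l j)) * cnj (a k * of_real (blaschke_factor m (l k)))
        / of_nat (l j + l k + 1) =
      a j * cnj (a k) * of_real (1 / (real (l j) + real (l k) + 1) -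
        blaschke_factor m (l j) * blaschke_factor m (l k) / (real (l j) + real (l k) + 1))"
      by (simp add: algebra_simps diff_divide_distrib)
    also have "\<dots> = of_real (2 * real m + 1) *
        (a j / of_nat (l j + m + 1) * cnj (a k / of_nat (l k + m + 1)))"
      unfolding blaschke_kernel_identity by (simp add: add_ac)
    finally show ?thesis .
  qed
  have "cauchy_form A l a - cauchy_form A l (\<lambda>k. a k * of_real (blaschke_factor m (l k))) =
      (\<Sum>j\<in>A. \<Sum>k\<in>A. of_real (2 * real m + 1) *
        (a j / of_nat (l j + m + 1) * cnj (a k / of_nat (l k + m + 1))))"
    unfolding cauchy_form_def sum_subtractf[symmetric] by (intro sum.cong refl *)
  also have "\<dots> = of_real (2 * real m + 1) *
      ((\<Sum>k\<in>A. a k / of_nat (l k + m + 1)) * cnj (\<Sum>k\<in>A. a k / of_nat (l k + m + 1)))"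
    by (simp only: cnj_sum sum_product) (simp only: sum_distrib_left)
  finally show ?thesis
    by (simp only: complex_norm_square of_real_mult)
qed

lemma Re_cauchy_form_blaschke_le:
  "Re (cauchy_form A l (\<lambda>k. a k * of_real (blaschke_factor m (l k)))) \<le> Re (cauchy_form A l a)"
proof -
  have "Re (cauchy_form A l a - cauchy_form A l (\<lambda>k. a k * of_real (blaschke_factor m (l k)))) \<ge> 0"
    unfolding cauchy_form_blaschke_diff Re_complex_of_real by simp
  then show ?thesis by simp
qed

lemma Re_cauchy_form_blaschke_prod_le:
  assumes "finite S"
  shows "Re (cauchy_form A l (\<lambda>k. a k * of_real (\<Prod>i\<in>S. blaschke_factor (l i) (l k))))
           \<le> Re (cauchy_form A l a)"
  using assms
proof (induction S)
  case (insert i S)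
  have "Re (cauchy_form A l (\<lambda>k. a k * of_real (\<Prod>i\<in>insert i S. blaschke_factor (l i) (l k))))
      = Re (cauchy_form A l (\<lambda>k. (a k * of_real (\<Prod>i\<in>S. blaschke_factor (l i) (l k))) *
          of_real (blaschke_factor (l i) (l k))))"
    using insert.hyps by (simp add: mult_ac)
  also have "\<dots> \<le> Re (cauchy_form A l (\<lambda>k. a k * of_real (\<Prod>i\<in>S. blaschke_factor (l i) (l k))))"
    by (rule Re_cauchy_form_blaschke_le)
  also note insert.IH
  finally show ?case .
qed simp

text \<open>Multiplying by the Blaschke factors of all the other exponents kills every coefficient
  but the one at \<open>n\<close>, so the smaller form collapses to a single diagonal term.\<close>

lemma coeff_le_cauchy_form:
  assumes "finite A" "n \<in> A"
  shows "(cmod (a n))\<^sup>2 * (\<Prod>i\<in>A - {n}. blaschke_factor (l i) (l n))\<^sup>2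
           \<le> (2 * real (l n) + 1) * Re (cauchy_form A l a)"
proof -
  define b where "b k = a k * of_real (\<Prod>i\<in>A - {n}. blaschke_factor (l i) (l k))" for k
  \<comment> \<open>The factor with index i = k vanishes.\<close>
  have b0: "b k = 0" if "k \<in> A - {n}" for k
    unfolding b_def using that assms
    by (auto simp: prod_zero_iff blaschke_factor_def intro!: bexI[of _ k])
  have "cauchy_form A l b = b n * cnj (b n) / of_nat (l n + l n + 1)"
    unfolding cauchy_form_def using assms b0
    by (simp add: sum.remove[of A n])
  also have "\<dots> = of_real ((cmod (b n))\<^sup>2 / (2 * real (l n) + 1))"
    by (simp add: complex_norm_square del: of_real_power)
  finally have "Re (cauchy_form A l b) = (cmod (b n))\<^sup>2 / (2 * real (l n) + 1)"
    by (simp only: Re_complex_of_real)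
  moreover have "Re (cauchy_form A l b) \<le> Re (cauchy_form A l a)"
    unfolding b_def using assms by (intro Re_cauchy_form_blaschke_prod_le) auto
  ultimately have "(cmod (b n))\<^sup>2 / (2 * real (l n) + 1) \<le> Re (cauchy_form A l a)" by simp
  then have "(cmod (b n))\<^sup>2 \<le> (2 * real (l n) + 1) * Re (cauchy_form A l a)"
    by (simp add: divide_le_eq mult.commute)
  then show ?thesis
    unfolding b_def by (simp add: norm_mult power_mult_distrib flip: of_real_prod)
qed

section \<open>Exponential bounds for inverse Blaschke products\<close>

lemma one_le_inverse_blaschke:
  "m \<noteq> l \<Longrightarrow> 1 \<le> (real l + real m + 1) / \<bar>real l - real m\<bar>"
  by (auto simp: divide_simps)

text \<open>The quotient l^l / l! is one term of the exponential series at l.\<close>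

lemma power_self_le_exp_fact: "real l ^ l \<le> exp (real l) * fact l"
proof -
  have "(real l ^ l /\<^sub>R fact l) \<le> (\<Sum>n. real l ^ n /\<^sub>R fact n)"
    using sum_le_suminf[OF summable_exp_generic[of "real l"], of "{l}"] by simp
  then show ?thesis by (simp add: exp_def divide_simps mult.commute)
qed

text \<open>The integers below l and those above l, up to 2l, contribute l! each.\<close>

lemma prod_abs_diff_window:
  "(\<Prod>m\<in>{..2*l} - {l}. \<bar>real l - real m\<bar>) = (fact l)\<^sup>2"
proof -
  have e: "{..2*l} - {l} = {..<l} \<union> {l<..2*l}" by auto
  have "(\<Prod>m<l. \<bar>real l - real m\<bar>) = (\<Prod>m<l. real (l - m))"
    by (intro prod.cong) auto
  also have "\<dots> = (\<Prod>m\<in>{1..l}. real m)"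
    by (rule prod.reindex_bij_witness[of _ "\<lambda>m. l - m" "\<lambda>m. l - m"]) auto
  finally have 1: "(\<Prod>m<l. \<bar>real l - real m\<bar>) = fact l" by (simp add: fact_prod)
  have "(\<Prod>m\<in>{l<..2*l}. \<bar>real l - real m\<bar>) = (\<Prod>m\<in>{1..l}. real m)"
    by (rule prod.reindex_bij_witness[of _ "\<lambda>m. m + l" "\<lambda>m. m - l"]) auto
  then have 2: "(\<Prod>m\<in>{l<..2*l}. \<bar>real l - real m\<bar>) = fact l" by (simp add: fact_prod)
  have "(\<Prod>m\<in>{..<l} \<union> {l<..2*l}. \<bar>real l - real m\<bar>) =
      (\<Prod>m<l. \<bar>real l - real m\<bar>) * (\<Prod>m\<in>{l<..2*l}. \<bar>real l - real m\<bar>)"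
    by (rule prod.union_disjoint) auto
  then show ?thesis by (simp only: e 1 2 power2_eq_square)
qed

text \<open>All factors are at least 1, so \<open>B\<close> may be enlarged to the full window.
  There each numerator is at most 4l, the denominators multiply to (l!)^2, and l^l \<le> e^l l!
  cancels the factorials, so the bound is only exponential in l.\<close>

lemma inverse_blaschke_window:
  assumes "l > 0" "B \<subseteq> {..2*l} - {l}"
  shows "(\<Prod>m\<in>B. (real l + real m + 1) / \<bar>real l - real m\<bar>) \<le> (4 * exp 1) ^ (2 * l)"
proof -
  have c: "card ({..2*l} - {l}) = 2 * l" by simp
  have "(\<Prod>m\<in>B. (real l + real m + 1) / \<bar>real l - real m\<bar>)
      \<le> (\<Prod>m\<in>{..2*l} - {l}. (real l + real m + 1) / \<bar>real l - real m\<bar>)"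
    using assms one_le_inverse_blaschke by (intro prod_mono2) (auto intro: order_trans[OF zero_le_one])
  also have "\<dots> = (\<Prod>m\<in>{..2*l} - {l}. (real l + real m + 1)) / (fact l)\<^sup>2"
    by (simp add: prod_dividef prod_abs_diff_window)
  also have "(\<Prod>m\<in>{..2*l} - {l}. (real l + real m + 1)) \<le> (\<Prod>m\<in>{..2*l} - {l}. 4 * real l)"
    using assms(1) by (intro prod_mono) auto
  also have "\<dots> = 4 ^ (2*l) * (real l ^ l)\<^sup>2"
    using c by (simp add: power_mult_distrib mult.commute flip: power_mult)
  also have "\<dots> \<le> 4 ^ (2*l) * (exp (real l) * fact l)\<^sup>2"
    by (intro mult_left_mono power_mono power_self_le_exp_fact) auto
  also have "4 ^ (2*l) * (exp (real l) * fact l)\<^sup>2 / (fact l)\<^sup>2 = (4 * exp 1) ^ (2 * l)"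
    using exp_of_nat_mult[of l "1::real"]
    by (simp add: power_mult_distrib mult.commute flip: power_mult)
  finally show ?thesis by (simp add: divide_right_mono)
qed

text \<open>The factor equals 1 + (2l + 1)/(m - l), where 2l + 1 \<le> 3l and m - l \<ge>
  m/2.\<close>

lemma inverse_blaschke_far:
  assumes "l > 0" "2 * l < m"
  shows "(real l + real m + 1) / \<bar>real l - real m\<bar> \<le> exp (real l * (6 / real m))"
proof -
  have "\<bar>real l - real m\<bar> = real m - real l" "real m - real l \<noteq> 0" using assms by auto
  then have "(real l + real m + 1) / \<bar>real l - real m\<bar> = 1 + (2 * real l + 1) / (real m - real l)"
    by (simp add: add_divide_eq_iff)
  also have "(2 * real l + 1) / (real m - real l) \<le> 3 * real l / (real m / 2)"
    using assms by (intro frac_le) auto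
  also have "1 + 3 * real l / (real m / 2) \<le> exp (3 * real l / (real m / 2))"
    by (rule exp_ge_add_one_self)
  finally show ?thesis by (simp add: mult_ac)
qed

text \<open>Exponents up to twice \<open>lam n\<close> fall under the window estimate. For the
  larger ones the exponents 6 \<open>lam n\<close> / \<open>lam i\<close> add up to at most 6
  \<open>lam n\<close> times the sum of the reciprocals.\<close>

lemma inverse_blaschke_prod_bound:
  fixes lam :: "nat \<Rightarrow> nat"
  assumes "inj lam" "\<And>n. lam n > 0" "summable (\<lambda>n. 1 / real (lam n))"
  obtains R where "R \<ge> 1"
    "\<And>A n. finite A \<Longrightarrow>
      (\<Prod>i\<in>A - {n}. (real (lam n) + real (lam i) + 1) / \<bar>real (lam n) - real (lam i)\<bar>) \<le> R ^ lam n"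
proof -
  define S where "S = (\<Sum>n. 1 / real (lam n))"
  have S0: "S \<ge> 0" unfolding S_def by (intro suminf_nonneg assms) auto
  \<comment> \<open>The first factor pays for the window, the second for the far exponents.\<close>
  define R :: real where "R = (4 * exp 1)\<^sup>2 * exp (6 * S)"
  have "1 \<le> 4 * exp (1::real)" using exp_ge_add_one_self[of "1::real"] by linarith
  then have "1 * 1 \<le> R"
    unfolding R_def using S0 by (intro mult_mono one_le_power) auto
  then have "R \<ge> 1" by simp
  moreover have "(\<Prod>i\<in>A - {n}. (real (lam n) + real (lam i) + 1) / \<bar>real (lam n) - real (lam i)\<bar>)
      \<le> R ^ lam n" if A: "finite A" for A n
  proof -
    define q where "q m = (real (lam n) + real m + 1) / \<bar>real (lam n) - real m\<bar>" for m
    define A1 where "A1 = {i \<in> A - {n}. lam i \<le> 2 * lam n}"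
    define A2 where "A2 = {i \<in> A - {n}. lam i > 2 * lam n}"
    have un: "A - {n} = A1 \<union> A2" "A1 \<inter> A2 = {}" "finite A1" "finite A2"
      using A by (auto simp: A1_def A2_def)
    have q0: "q m \<ge> 0" for m unfolding q_def by simp
    \<comment> \<open>Injectivity turns the product over indices into one over distinct integers of
      the window.\<close>
    have "(\<Prod>i\<in>A1. q (lam i)) = (\<Prod>m\<in>lam ` A1. q m)"
      using assms(1) by (subst prod.reindex) (auto intro: inj_on_subset)
    also have "\<dots> \<le> (4 * exp 1) ^ (2 * lam n)"
      unfolding q_def using assms(1,2)
      by (intro inverse_blaschke_window) (auto simp: A1_def dest: injD)
    finally have 1: "(\<Prod>i\<in>A1. q (lam i)) \<le> (4 * exp 1) ^ (2 * lam n)" .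
    have "(\<Prod>i\<in>A2. q (lam i)) \<le> (\<Prod>i\<in>A2. exp (real (lam n) * (6 / real (lam i))))"

      using assms(2) unfolding q_def
      by (intro prod_mono conjI inverse_blaschke_far) (simp_all add: A2_def)
    also have "\<dots> = exp (real (lam n) * (6 * (\<Sum>i\<in>A2. 1 / real (lam i))))"
      using un(4) by (simp only: exp_sum[symmetric] sum_distrib_left) (simp add: mult_ac)
    also have "(\<Sum>i\<in>A2. 1 / real (lam i)) \<le> S"
      unfolding S_def using un by (intro sum_le_suminf assms) auto
    finally have 2: "(\<Prod>i\<in>A2. q (lam i)) \<le> exp (real (lam n) * (6 * S))"
      by (simp add: mult_left_mono)
    have "(\<Prod>i\<in>A - {n}. q (lam i)) = (\<Prod>i\<in>A1. q (lam i)) * (\<Prod>i\<in>A2. q (lam i))"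
      using un by (simp add: prod.union_disjoint)
    also have "\<dots> \<le> (4 * exp 1) ^ (2 * lam n) * exp (real (lam n) * (6 * S))"
      using 1 2 q0 by (intro mult_mono prod_nonneg) auto
    also have "\<dots> = R ^ lam n"
      unfolding R_def power_mult_distrib[of "(4 * exp 1)\<^sup>2"] by (simp only: exp_of_nat_mult power_mult)
    finally show ?thesis unfolding q_def .
  qed
  ultimately show ?thesis using that by blast
qed

section \<open>The space \<open>L\<^sup>2(0,1)\<close>\<close>

abbreviation I01 :: "real measure" where
  "I01 \<equiv> lebesgue_on {0<..<1}"

lemma finite_measure_I01: "finite_measure I01"
  by (intro finite_measureI) (simp add: emeasure_restrict_space)

text \<open>Every interval (0, \<epsilon>) meets (0,1) in positive measure. This yields points
  arbitrarily close to 0 at which an almost everywhere identity really holds, as the identity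
  theorem requires.\<close>

lemma AE_I01_imp_ex:
  assumes "AE t in I01. Q t" "0 < \<epsilon>"
  obtains t where "0 < t" "t < \<epsilon>" "t < 1" "Q t"
proof -
  define e where "e = min \<epsilon> 1"
  have e: "0 < e" "e \<le> 1" "e \<le> \<epsilon>" using assms(2) by (auto simp: e_def)
  have "\<exists>t\<in>{0<..<e}. Q t"
  proof (rule ccontr)
    assume *: "\<not> (\<exists>t\<in>{0<..<e}. Q t)"
    have "AE t in lebesgue. t \<in> {0<..<1} \<longrightarrow> Q t"
      using assms(1) by (subst (asm) AE_restrict_space_iff) auto
    then have "AE t in lebesgue. t \<notin> {0<..<e}"
      by eventually_elim (use * e in force)
    then have "{0<..<e} \<in> null_sets lebesgue"
      by (subst AE_iff_null_sets) auto
    then have "emeasure lebesgue {0<..<e} = 0" by auto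
    then show False using e by simp
  qed
  then show ?thesis using that e by force
qed

section \<open>Linear structure and the Cauchy-Schwarz inequality\<close>

lemma L2_spaceD [dest]:
  assumes "f \<in> L2_space"
  shows "f \<in> borel_measurable I01" "integrable I01 (\<lambda>t. (cmod (f t))\<^sup>2)"
  using assms by (auto simp: L2_space_def)

lemma L2_norm_power2: "(L2_norm f)\<^sup>2 = (LINT t|I01. (cmod (f t))\<^sup>2)"
  by (simp add: L2_norm_def)

lemma L2_norm_nonneg [simp]: "L2_norm f \<ge> 0"
  by (simp add: L2_norm_def)

text \<open>The cruder bound with factors 2 stands in for the triangle inequality; it serves to
  bound the norms of approximants.\<close>

lemma L2_space_add:
  assumes "f \<in> L2_space" "g \<in> L2_space"
  shows "(\<lambda>t. f t + g t) \<in> L2_space"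
    and "(L2_norm (\<lambda>t. f t + g t))\<^sup>2 \<le> 2 * (L2_norm f)\<^sup>2 + 2 * (L2_norm g)\<^sup>2"
proof -
  note [measurable] = L2_spaceD(1)[OF assms(1)] L2_spaceD(1)[OF assms(2)]
  have b: "(cmod (x + y))\<^sup>2 \<le> 2 * (cmod x)\<^sup>2 + 2 * (cmod y)\<^sup>2" for x y
  proof -
    have "(cmod (x + y))\<^sup>2 \<le> (cmod x + cmod y)\<^sup>2"
      by (intro power_mono norm_triangle_ineq) auto
    also have "\<dots> \<le> 2 * (cmod x)\<^sup>2 + 2 * (cmod y)\<^sup>2"
      using sum_squares_bound[of "cmod x" "cmod y"] by (simp add: power2_sum)
    finally show ?thesis .
  qed
  have i: "integrable I01 (\<lambda>t. 2 * (cmod (f t))\<^sup>2 + 2 * (cmod (g t))\<^sup>2)"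
    using L2_spaceD(2)[OF assms(1)] L2_spaceD(2)[OF assms(2)] by simp
  then have j: "integrable I01 (\<lambda>t. (cmod (f t + g t))\<^sup>2)"
    by (rule Bochner_Integration.integrable_bound) (use b in auto)
  then show "(\<lambda>t. f t + g t) \<in> L2_space" by (simp add: L2_space_def)
  have "(LINT t|I01. (cmod (f t + g t))\<^sup>2) \<le> (LINT t|I01. 2 * (cmod (f t))\<^sup>2 + 2 * (cmod (g t))\<^sup>2)"
    using i j b by (intro integral_mono) auto
  also have "\<dots> = 2 * (LINT t|I01. (cmod (f t))\<^sup>2) + 2 * (LINT t|I01. (cmod (g t))\<^sup>2)"
    using L2_spaceD(2)[OF assms(1)] L2_spaceD(2)[OF assms(2)] by simp
  finally show "(L2_norm (\<lambda>t. f t + g t))\<^sup>2 \<le> 2 * (L2_norm f)\<^sup>2 + 2 * (L2_norm g)\<^sup>2"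
    by (simp only: L2_norm_power2)
qed

lemma L2_uminus:
  assumes "f \<in> L2_space"
  shows "(\<lambda>t. - f t) \<in> L2_space" "L2_norm (\<lambda>t. - f t) = L2_norm f"
  using assms by (auto simp: L2_space_def L2_norm_def)

lemma L2_space_diff:
  assumes "f \<in> L2_space" "g \<in> L2_space"
  shows "(\<lambda>t. f t - g t) \<in> L2_space"
    and "(L2_norm (\<lambda>t. f t - g t))\<^sup>2 \<le> 2 * (L2_norm f)\<^sup>2 + 2 * (L2_norm g)\<^sup>2"
  using L2_space_add[OF assms(1) L2_uminus(1)[OF assms(2)]] L2_uminus(2)[OF assms(2)] by simp_all

lemma L2_mult_integrable:
  assumes "f \<in> L2_space" "g \<in> L2_space"
  shows "integrable I01 (\<lambda>t. cmod (f t) * cmod (g t))"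
    and "integrable I01 (\<lambda>t. f t * cnj (g t))"
proof -
  note [measurable] = L2_spaceD(1)[OF assms(1)] L2_spaceD(1)[OF assms(2)]
  have b: "x * y \<le> x\<^sup>2 + y\<^sup>2" for x y :: real
    using sum_squares_bound[of x y] zero_le_power2[of x] zero_le_power2[of y]
    by (cases "0 \<le> x * y") linarith+
  have i: "integrable I01 (\<lambda>t. (cmod (f t))\<^sup>2 + (cmod (g t))\<^sup>2)"
    using L2_spaceD(2)[OF assms(1)] L2_spaceD(2)[OF assms(2)] by simp
  show "integrable I01 (\<lambda>t. cmod (f t) * cmod (g t))"
    by (rule Bochner_Integration.integrable_bound[OF i]) (use b in auto)
  have "cnj \<in> borel_measurable borel"
    by (intro borel_measurable_continuous_onI continuous_intros)
  from measurable_compose[OF L2_spaceD(1)[OF assms(2)] this]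
  have [measurable]: "(\<lambda>t. cnj (g t)) \<in> borel_measurable I01" .
  show "integrable I01 (\<lambda>t. f t * cnj (g t))"
    by (rule Bochner_Integration.integrable_bound[OF i]) (use b in \<open>auto simp: norm_mult\<close>)
qed

lemma L2_Cauchy_Schwarz:
  assumes "f \<in> L2_space" "g \<in> L2_space"
  shows "cmod (L2_inner f g) \<le> L2_norm f * L2_norm g"
proof -
  note [measurable] = L2_spaceD(1)[OF assms(1)] L2_spaceD(1)[OF assms(2)]
  define A where "A = (LINT t|I01. (cmod (f t))\<^sup>2)"
  define B where "B = (LINT t|I01. cmod (f t) * cmod (g t))"
  define C where "C = (LINT t|I01. (cmod (g t))\<^sup>2)"
  have int: "integrable I01 (\<lambda>t. (cmod (f t))\<^sup>2)" "integrable I01 (\<lambda>t. (cmod (g t))\<^sup>2)"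
    "integrable I01 (\<lambda>t. cmod (f t) * cmod (g t))"
    using L2_spaceD(2)[OF assms(1)] L2_spaceD(2)[OF assms(2)] L2_mult_integrable(1)[OF assms] by simp_all
  have A: "A \<ge> 0" and B: "B \<ge> 0" unfolding A_def B_def by simp_all
  have "B\<^sup>2 \<le> A * C"
  \<comment> \<open>If \<open>A = 0\<close> then \<open>f\<close> vanishes almost everywhere, hence
    so does the product.\<close>
  proof (cases "A = 0")
    case True
    then have "AE t in I01. (cmod (f t))\<^sup>2 = 0"
      unfolding A_def using int by (subst (asm) integral_nonneg_eq_0_iff_AE) auto
    then have "AE t in I01. cmod (f t) * cmod (g t) = 0" by eventually_elim auto
    then have "B = 0" unfolding B_def by (intro integral_eq_zero_AE)
    then show ?thesis using True by simp
  next
    case False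
    \<comment> \<open>The minimiser of the quadratic s^2 A - 2 s B + C, whose minimum must be
      non-negative.\<close>
    define s where "s = B / A"
    have "0 \<le> (LINT t|I01. (s * cmod (f t) - cmod (g t))\<^sup>2)" by simp
    also have "\<dots> = (LINT t|I01. s\<^sup>2 * (cmod (f t))\<^sup>2 - 2 * s * (cmod (f t) * cmod (g t)) + (cmod (g t))\<^sup>2)"
      by (intro Bochner_Integration.integral_cong) (auto simp: power2_eq_square algebra_simps)
    also have "\<dots> = s\<^sup>2 * A - 2 * s * B + C"
      unfolding A_def B_def C_def using int
      by (subst Bochner_Integration.integral_add Bochner_Integration.integral_diff; simp)+
    also have "\<dots> = C - B\<^sup>2 / A"
      using False by (simp add: s_def power2_eq_square field_simps)
    finally have "B\<^sup>2 / A \<le> C" by simp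
    then show ?thesis using False A by (simp add: pos_divide_le_eq mult.commute)
  qed
  then have "B \<le> sqrt A * sqrt C" using B by (metis real_le_rsqrt real_sqrt_mult)
  moreover have "cmod (L2_inner f g) \<le> B"
    unfolding L2_inner_def B_def
    using integral_norm_bound[of I01 "\<lambda>t. f t * cnj (g t)"] by (simp add: norm_mult)
  ultimately show ?thesis by (simp add: L2_norm_def A_def C_def)
qed

lemma L2_inner_diff_left:
  assumes "f \<in> L2_space" "g \<in> L2_space" "h \<in> L2_space"
  shows "L2_inner (\<lambda>t. f t - g t) h = L2_inner f h - L2_inner g h"
  unfolding L2_inner_def using L2_mult_integrable(2) assms
  by (simp add: left_diff_distrib)

lemma L2_inner_tendsto:
  assumes "\<And>j. P j \<in> L2_space" "f \<in> L2_space" "g \<in> L2_space"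
    and "(\<lambda>j. L2_norm (\<lambda>t. f t - P j t)) \<longlonglongrightarrow> 0"
  shows "(\<lambda>j. L2_inner (P j) g) \<longlonglongrightarrow> L2_inner f g"
proof -
  have "(\<lambda>j. L2_norm (\<lambda>t. f t - P j t) * L2_norm g) \<longlonglongrightarrow> 0"
    using assms(4) by (rule tendsto_mult_left_zero)
  then have "(\<lambda>j. L2_inner (\<lambda>t. f t - P j t) g) \<longlonglongrightarrow> 0"
    by (rule Lim_null_comparison[rotated])
       (use assms L2_Cauchy_Schwarz L2_space_diff in auto)
  then have "(\<lambda>j. L2_inner f g - L2_inner (\<lambda>t. f t - P j t) g) \<longlonglongrightarrow> L2_inner f g - 0"
    by (intro tendsto_intros)
  then show ?thesis using assms by (simp add: L2_inner_diff_left)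
qed

lemma continuous_on_imp_L2_space:
  fixes g :: "real \<Rightarrow> complex"
  assumes "continuous_on {0..1} g"
  shows "g \<in> L2_space"
proof -
  have m: "g \<in> borel_measurable I01"
    by (intro continuous_imp_measurable_on_sets_lebesgue) (auto intro: continuous_on_subset[OF assms])
  obtain B where B: "\<forall>t\<in>{0..1}. cmod (g t) \<le> B"
    using compact_imp_bounded[OF compact_continuous_image[OF assms compact_Icc]]
    unfolding bounded_iff by blast
  interpret finite_measure I01 by (rule finite_measure_I01)
  have "integrable I01 (\<lambda>t. (cmod (g t))\<^sup>2)"
    by (rule integrable_const_bound[of _ "B\<^sup>2"])
       (use m B in \<open>auto simp: space_restrict_space intro!: AE_I2 power_mono\<close>)
  then show ?thesis using m by (simp add: L2_space_def)
qed

section \<open>Muentz polynomials: norm and coefficients\<close>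

lemma muentz_system_L2: "muentz_system lam n \<in> L2_space"
  unfolding muentz_system_def by (intro continuous_on_imp_L2_space continuous_intros)

lemma muentz_poly_L2: "(\<lambda>t. \<Sum>n<N. a n * muentz_system lam n t) \<in> L2_space"
  unfolding muentz_system_def by (intro continuous_on_imp_L2_space continuous_intros)

lemma integrable_I01_power: "integrable I01 (\<lambda>t. t ^ k)"
  and integral_I01_power: "(LINT t|I01. t ^ k) = 1 / real (Suc k)"
proof -
  interpret finite_measure I01 by (rule finite_measure_I01)
  show i: "integrable I01 (\<lambda>t. t ^ k)"
    by (rule integrable_const_bound[of _ 1])
       (auto simp: space_restrict_space power_le_one intro!: AE_I2
         continuous_imp_measurable_on_sets_lebesgue continuous_intros)
  have "(LINT t|I01. t ^ k) = integral {0<..<1} (\<lambda>t. t ^ k)"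
    by (rule lebesgue_integral_eq_integral[OF i]) auto
  also have "\<dots> = integral {0..1} (\<lambda>t. t ^ k)"
    by (simp only: integral_open_interval_real)
  also have "\<dots> = 1 ^ Suc k / real (Suc k) - 0 ^ Suc k / real (Suc k)"
    by (intro integral_unique fundamental_theorem_of_calculus)
       (auto intro!: derivative_eq_intros simp flip: has_real_derivative_iff_has_vector_derivative
         simp del: of_nat_Suc power_Suc)
  finally show "(LINT t|I01. t ^ k) = 1 / real (Suc k)"
    by simp
qed

text \<open>Expand the square and integrate the monomials. This carries the estimate for the Cauchy
  form over to L2(0,1).\<close>

lemma L2_norm_muentz_poly:
  "(L2_norm (\<lambda>t. \<Sum>n<N. a n * muentz_system lam n t))\<^sup>2 = Re (cauchy_form {..<N} lam a)"
proof -
  let ?P = "\<lambda>t. \<Sum>n<N. a n * muentz_system lam n t"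
  have "complex_of_real ((L2_norm ?P)\<^sup>2) = (LINT t|I01. of_real ((cmod (?P t))\<^sup>2))"
    unfolding L2_norm_power2 by (rule integral_complex_of_real[symmetric])
  also have "(\<lambda>t. complex_of_real ((cmod (?P t))\<^sup>2)) =
      (\<lambda>t. \<Sum>j<N. \<Sum>k<N. a j * cnj (a k) * of_real (t ^ (lam j + lam k)))"
  proof
    fix t
    have "complex_of_real ((cmod (?P t))\<^sup>2) =
        (\<Sum>j<N. \<Sum>k<N. (a j * muentz_system lam j t) * cnj (a k * muentz_system lam k t))"
      by (simp only: complex_norm_square cnj_sum sum_product)
    also have "\<dots> = (\<Sum>j<N. \<Sum>k<N. a j * cnj (a k) * of_real (t ^ (lam j + lam k)))"
      by (intro sum.cong refl) (simp add: muentz_system_def power_add)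
    finally show "complex_of_real ((cmod (?P t))\<^sup>2) =
        (\<Sum>j<N. \<Sum>k<N. a j * cnj (a k) * of_real (t ^ (lam j + lam k)))" .
  qed
  also have "(LINT t|I01. (\<Sum>j<N. \<Sum>k<N. a j * cnj (a k) * of_real (t ^ (lam j + lam k)))) =
      (\<Sum>j<N. \<Sum>k<N. a j * cnj (a k) * of_real (LINT t|I01. t ^ (lam j + lam k)))"
    using integrable_I01_power by (simp add: Bochner_Integration.integral_sum del: of_real_power)
  also have "\<dots> = cauchy_form {..<N} lam a"
    unfolding cauchy_form_def integral_I01_power by (simp add: add_ac)
  finally show ?thesis by (metis Re_complex_of_real)
qed

lemma biorthogonal_L2:
  "biorthogonal_family lam r \<Longrightarrow> r n \<in> L2_space"
  by (simp add: biorthogonal_family_def muentz_closure_def L2_closed_span_def)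

text \<open>Pairing with the biorthogonal family reads off coefficients; an index beyond the length
  of the polynomial gives 0.\<close>

lemma L2_inner_muentz_poly:
  assumes "biorthogonal_family lam r"
  shows "L2_inner (\<lambda>t. \<Sum>n<N. a n * muentz_system lam n t) (r m) = (if m < N then a m else 0)"
proof -
  have r: "r m \<in> L2_space"
    using assms by (rule biorthogonal_L2)
  have "L2_inner (\<lambda>t. \<Sum>n<N. a n * muentz_system lam n t) (r m) =
      (LINT t|I01. (\<Sum>n<N. a n * (muentz_system lam n t * cnj (r m t))))"
    unfolding L2_inner_def by (simp add: sum_distrib_right mult.assoc)
  also have "\<dots> = (\<Sum>n<N. a n * L2_inner (muentz_system lam n) (r m))"
    unfolding L2_inner_def using L2_mult_integrable(2)[OF muentz_system_L2 r]
    by (simp add: Bochner_Integration.integral_sum)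
  also have "\<dots> = (\<Sum>n<N. if m = n then a n else 0)"
    using assms by (intro sum.cong) (auto simp: biorthogonal_family_def)
  finally show ?thesis by simp
qed

section \<open>Taylor coefficients of functions in the Hardy space\<close>

lemma taylor_coeff_sums:
  assumes "f holomorphic_on ball 0 1" "z \<in> ball 0 1"
  shows "(\<lambda>n. taylor_coeff f n * z ^ n) sums f z"
  using holomorphic_power_series[OF assms] by (simp add: taylor_coeff_def fps_expansion_def)

lemma taylor_coeff_unique:
  assumes "eventually (\<lambda>z. (\<lambda>n. b n * z ^ n) sums f z) (nhds 0)"
  shows "taylor_coeff f = b"
proof -
  have "f has_fps_expansion Abs_fps b"
    by (rule has_fps_expansionI) (use assms in simp)
  then show ?thesis
    by (simp add: taylor_coeff_def fps_expansion_eqI fun_eq_iff)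
qed

section \<open>Parseval's identity on circles and the coefficient description of the Hardy
  space\<close>

lemma has_integral_cis_multiple:
  "((\<lambda>\<theta>. cis (of_int m * \<theta>)) has_integral (if m = 0 then 2 * pi else 0)) {0..2*pi}"
proof (cases "m = 0")
  case True
  then show ?thesis
    using has_integral_const_real[of "1::complex" 0 "2 * pi"] by (simp add: scaleR_conv_of_real)
next
  case False
  define F where "F \<theta> = cis (of_int m * \<theta>) / (\<i> * of_int m)" for \<theta> :: real
  have "((\<lambda>\<theta>. cis (of_int m * \<theta>)) has_integral (F (2 * pi) - F 0)) {0..2*pi}"
  proof (rule fundamental_theorem_of_calculus)
    fix x :: real
    show "(F has_vector_derivative cis (of_int m * x)) (at x within {0..2*pi})"
      unfolding F_def cis_conv_exp using False
      by (auto intro!: derivative_eq_intros has_vector_derivative_real_field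
          simp: exp_of_real field_simps)
  qed simp
  moreover have "cis (of_int m * (2 * pi)) = 1"
    using cis_multiple_2pi[of "of_int m"] by (simp add: mult.commute)
  ultimately show ?thesis using False by (simp add: F_def)
qed

text \<open>Expanding the square produces \<open>cis\<close> at differences of exponents, taken in
  the integers since they may be negative; only the diagonal survives integration.\<close>

lemma has_integral_trig_poly:
  "((\<lambda>\<theta>. (cmod (\<Sum>n<N. a n * cis \<theta> ^ n))\<^sup>2) has_integral (2 * pi * (\<Sum>n<N. (cmod (a n))\<^sup>2))) {0..2*pi}"
proof -
  have eq: "of_real ((cmod (\<Sum>n<N. a n * cis \<theta> ^ n))\<^sup>2) =
      (\<Sum>j<N. \<Sum>k<N. a j * cnj (a k) * cis (of_int (int j - int k) * \<theta>))" for \<theta>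
  proof -
    have "complex_of_real ((cmod (\<Sum>n<N. a n * cis \<theta> ^ n))\<^sup>2) =
        (\<Sum>j<N. \<Sum>k<N. (a j * cis \<theta> ^ j) * cnj (a k * cis \<theta> ^ k))"
      by (simp only: complex_norm_square cnj_sum sum_product)
    also have "\<dots> = (\<Sum>j<N. \<Sum>k<N. a j * cnj (a k) * cis (of_int (int j - int k) * \<theta>))"
    proof (intro sum.cong refl)
      fix j k
      have *: "cis (of_int (int j - int k) * \<theta>) = cis \<theta> ^ j * cnj (cis \<theta> ^ k)"
        by (simp only: Complex.DeMoivre cis_cnj cis_mult) (simp add: left_diff_distrib)
      show "(a j * cis \<theta> ^ j) * cnj (a k * cis \<theta> ^ k) =
          a j * cnj (a k) * cis (of_int (int j - int k) * \<theta>)"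
        unfolding * complex_cnj_mult by (simp only: mult_ac)
    qed
    finally show ?thesis .
  qed
  have "((\<lambda>\<theta>. complex_of_real ((cmod (\<Sum>n<N. a n * cis \<theta> ^ n))\<^sup>2)) has_integral
      (\<Sum>j<N. \<Sum>k<N. a j * cnj (a k) * (if int j - int k = 0 then 2 * pi else 0))) {0..2*pi}"
    unfolding eq by (intro has_integral_sum has_integral_mult_right has_integral_cis_multiple) auto
  also have "(\<Sum>j<N. \<Sum>k<N. a j * cnj (a k) * (if int j - int k = 0 then 2 * pi else 0)) =
      (\<Sum>j<N. \<Sum>k<N. if k = j then a j * cnj (a j) * (2 * pi) else 0)"
    by (intro sum.cong refl) auto
  also have "\<dots> = (\<Sum>j<N. of_real (2 * pi * (cmod (a j))\<^sup>2))"
    by (intro sum.cong refl) (simp add: complex_norm_square mult_ac del: of_real_power)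
  also have "\<dots> = of_real (2 * pi * (\<Sum>n<N. (cmod (a n))\<^sup>2))"
    by (simp add: sum_distrib_left)
  finally have "((\<lambda>\<theta>. complex_of_real ((cmod (\<Sum>n<N. a n * cis \<theta> ^ n))\<^sup>2)) has_integral
      of_real (2 * pi * (\<Sum>n<N. (cmod (a n))\<^sup>2))) {0..2*pi}" .
  from has_integral_linear[OF this bounded_linear_Re] show ?thesis
    by (simp only: o_def Re_complex_of_real)
qed

text \<open>Parseval's identity for the power series, obtained from its partial sums by dominated
  convergence.\<close>

lemma circle_integral_sums:
  assumes f: "f holomorphic_on ball 0 1" and \<rho>: "0 < \<rho>" "\<rho> < 1"
  shows "(\<lambda>n. 2 * pi * (cmod (taylor_coeff f n) * \<rho> ^ n)\<^sup>2) sums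
           integral {0..2*pi} (\<lambda>\<theta>. (cmod (f (complex_of_real \<rho> * cis \<theta>)))\<^sup>2)"
proof -
  define a where "a n = taylor_coeff f n * of_real \<rho> ^ n" for n
  \<comment> \<open>The midpoint (1 + \<rho>)/2 lies strictly between \<rho> and 1, so convergence
    there gives absolute convergence on the circle of radius \<rho>.\<close>
  have "summable (\<lambda>n. taylor_coeff f n * of_real ((1 + \<rho>) / 2) ^ n)"
    by (rule sums_summable, rule taylor_coeff_sums[OF f]) (use \<rho> in \<open>simp del: of_real_divide of_real_add\<close>)
  then have summ: "summable (\<lambda>n. cmod (a n))"
    unfolding a_def by (rule powser_insidea) (use \<rho> in \<open>simp only: norm_of_real\<close>, simp)
  define S where "S N \<theta> = (\<Sum>n<N. a n * cis \<theta> ^ n)" for N \<theta>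
  have int: "((\<lambda>\<theta>. (cmod (S N \<theta>))\<^sup>2) has_integral (2 * pi * (\<Sum>n<N. (cmod (a n))\<^sup>2))) {0..2*pi}" for N
    unfolding S_def by (rule has_integral_trig_poly)
  have "(\<lambda>N. integral {0..2*pi} (\<lambda>\<theta>. (cmod (S N \<theta>))\<^sup>2)) \<longlonglongrightarrow>
      integral {0..2*pi} (\<lambda>\<theta>. (cmod (f (complex_of_real \<rho> * cis \<theta>)))\<^sup>2)"
  proof (rule dominated_convergence(2))
    show "(\<lambda>\<theta>. (cmod (S N \<theta>))\<^sup>2) integrable_on {0..2*pi}" for N
      using int by blast
    show "(\<lambda>_::real. (\<Sum>n. cmod (a n))\<^sup>2) integrable_on {0..2*pi}"
      by (rule integrable_const_ivl)
    fix N :: nat and \<theta> :: real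
    have "cmod (S N \<theta>) \<le> (\<Sum>n<N. cmod (a n))"
      unfolding S_def by (rule order_trans[OF norm_sum]) (simp add: norm_mult norm_power)
    also have "\<dots> \<le> (\<Sum>n. cmod (a n))"
      by (rule sum_le_suminf[OF summ]) auto
    finally show "norm ((cmod (S N \<theta>))\<^sup>2) \<le> (\<Sum>n. cmod (a n))\<^sup>2"
      by (simp add: power_mono)
  next
    fix \<theta> :: real
    have "(\<lambda>n. taylor_coeff f n * (of_real \<rho> * cis \<theta>) ^ n) sums f (of_real \<rho> * cis \<theta>)"
      using \<rho> by (intro taylor_coeff_sums f) (simp add: norm_mult)
    then have "(\<lambda>N. S N \<theta>) \<longlonglongrightarrow> f (of_real \<rho> * cis \<theta>)"
      by (simp add: sums_def S_def a_def power_mult_distrib mult.assoc)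
    then show "(\<lambda>N. (cmod (S N \<theta>))\<^sup>2) \<longlonglongrightarrow> (cmod (f (of_real \<rho> * cis \<theta>)))\<^sup>2"
      by (intro tendsto_intros)
  qed
  moreover have "integral {0..2*pi} (\<lambda>\<theta>. (cmod (S N \<theta>))\<^sup>2) =
      (\<Sum>n<N. 2 * pi * (cmod (taylor_coeff f n) * \<rho> ^ n)\<^sup>2)" for N
    using integral_unique[OF int[of N]] \<rho>
    by (simp add: a_def norm_mult norm_power sum_distrib_left)
  ultimately show ?thesis by (simp add: sums_def)
qed

text \<open>By Parseval the circle means are series in \<rho> with non-negative terms. A bound on
  the means passes to each partial sum as \<rho> tends to 1; conversely \<rho>^n \<le> 1 bounds the
  means termwise.\<close>

lemma hardy2_iff:
  "f \<in> hardy2 \<longleftrightarrow> f holomorphic_on ball 0 1 \<and> summable (\<lambda>n. (cmod (taylor_coeff f n))\<^sup>2)"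
proof (intro iffI conjI)
  assume f: "f \<in> hardy2"
  then show hol: "f holomorphic_on ball 0 1" by (simp add: hardy2_def)
  obtain B where B: "\<forall>\<rho>\<in>{0<..<1}.
      integral {0..2*pi} (\<lambda>\<theta>. (cmod (f (complex_of_real \<rho> * cis \<theta>)))\<^sup>2) \<le> B"
    using f unfolding hardy2_def bdd_above_def by blast
  show "summable (\<lambda>n. (cmod (taylor_coeff f n))\<^sup>2)"
  proof (rule summableI_nonneg_bounded)
    fix N
    \<comment> \<open>The factor \<open>1 ^ n\<close> is kept so that the left side is visibly the
      limit at \<rho> = 1.\<close>
    have "(\<Sum>n<N. 2 * pi * (cmod (taylor_coeff f n) * 1 ^ n)\<^sup>2) \<le> B"
    proof (rule tendsto_upperbound)
      show "((\<lambda>\<rho>. \<Sum>n<N. 2 * pi * (cmod (taylor_coeff f n) * \<rho> ^ n)\<^sup>2) \<longlongrightarrow>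
          (\<Sum>n<N. 2 * pi * (cmod (taylor_coeff f n) * 1 ^ n)\<^sup>2)) (at_left 1)"
        by (intro tendsto_intros)
      have "(\<Sum>n<N. 2 * pi * (cmod (taylor_coeff f n) * \<rho> ^ n)\<^sup>2) \<le> B"
        if \<rho>: "0 < \<rho>" "\<rho> < 1" for \<rho>
      proof -
        note s = circle_integral_sums[OF hol \<rho>]
        show ?thesis
          using sum_le_suminf[OF sums_summable[OF s], of "{..<N}"] sums_unique[OF s] bspec[OF B, of \<rho>] \<rho>
          by simp
      qed
      then show "\<forall>\<^sub>F \<rho> in at_left 1. (\<Sum>n<N. 2 * pi * (cmod (taylor_coeff f n) * \<rho> ^ n)\<^sup>2) \<le> B"
        using eventually_at_left_real[of 0 "1::real"] by (auto elim!: eventually_mono)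
    qed simp
    then show "(\<Sum>n<N. (cmod (taylor_coeff f n))\<^sup>2) \<le> B / (2 * pi)"
      by (simp add: sum_distrib_left[symmetric] pos_le_divide_eq mult_ac)
  qed simp
next
  assume "f holomorphic_on ball 0 1 \<and> summable (\<lambda>n. (cmod (taylor_coeff f n))\<^sup>2)"
  then have hol: "f holomorphic_on ball 0 1"
    and summ: "summable (\<lambda>n. 2 * pi * (cmod (taylor_coeff f n))\<^sup>2)" by auto
  have "integral {0..2*pi} (\<lambda>\<theta>. (cmod (f (complex_of_real \<rho> * cis \<theta>)))\<^sup>2)
      \<le> (\<Sum>n. 2 * pi * (cmod (taylor_coeff f n))\<^sup>2)" if \<rho>: "\<rho> \<in> {0<..<1}" for \<rho>
  proof (rule sums_le[OF _ circle_integral_sums[OF hol] summable_sums[OF summ]])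
    show "2 * pi * (cmod (taylor_coeff f n) * \<rho> ^ n)\<^sup>2 \<le> 2 * pi * (cmod (taylor_coeff f n))\<^sup>2" for n
      using \<rho> by (intro mult_left_mono power_mono mult_left_le power_le_one) auto
  qed (use \<rho> in auto)
  then have "bdd_above ((\<lambda>\<rho>. integral {0..2*pi} (\<lambda>\<theta>. (cmod (f (complex_of_real \<rho> * cis \<theta>)))\<^sup>2)) ` {0<..<1})"
    by (rule bdd_aboveI2)
  then show "f \<in> hardy2" using hol by (simp add: hardy2_def)
qed

section \<open>Muentz sequences\<close>

locale muentz_sequence =
  fixes lam :: "nat \<Rightarrow> nat"
  assumes mono: "strict_mono lam"
    and pos: "lam n > 0"
    and summable_inverse: "summable (\<lambda>n. 1 / real (lam n))"
begin

text \<open>Strict monotonicity gives n \<le> \<open>lam n\<close>, hence a geometric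
  majorant.\<close>

lemma summable_power_lam:
  fixes x :: real
  assumes "0 \<le> x" "x < 1"
  shows "summable (\<lambda>n. x ^ lam n)"
proof (rule summable_comparison_test'[where N = 0])
  show "summable (\<lambda>n. x ^ n)" using assms by (intro summable_geometric) auto
  show "norm (x ^ lam n) \<le> x ^ n" for n
    using assms seq_suble[OF mono, of n] by (simp add: power_decreasing)
qed

text \<open>Combines \<open>coeff_le_cauchy_form\<close> with the bound for inverse Blaschke
  products. The constant depends on neither the length nor the coefficients of the polynomial, so it
  survives passage to limits.\<close>

lemma muentz_poly_bound:
  obtains R where "R \<ge> 1"
    "\<And>N a n. n < N \<Longrightarrow>
       cmod (a n) \<le> R ^ lam n * L2_norm (\<lambda>t. \<Sum>k<N. a k * muentz_system lam k t)"
proof -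
  have inj: "inj lam" using mono by (rule strict_mono_imp_inj_on)
  obtain R where R: "R \<ge> 1" "\<And>A n. finite A \<Longrightarrow>
      (\<Prod>i\<in>A - {n}. (real (lam n) + real (lam i) + 1) / \<bar>real (lam n) - real (lam i)\<bar>) \<le> R ^ lam n"
    using inverse_blaschke_prod_bound[OF inj pos summable_inverse] by blast
  have "cmod (a n) \<le> (3 * R) ^ lam n * L2_norm (\<lambda>t. \<Sum>k<N. a k * muentz_system lam k t)"
    if n: "n < N" for N n and a :: "nat \<Rightarrow> complex"
  proof -
    define P where "P = L2_norm (\<lambda>t. \<Sum>k<N. a k * muentz_system lam k t)"
    have P: "0 \<le> P" by (simp add: P_def)
    define p where "p = (\<Prod>i\<in>{..<N} - {n}. blaschke_factor (lam i) (lam n))"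
    \<comment> \<open>The reciprocal of the absolute value of \<open>p\<close>.\<close>
    define q where "q = (\<Prod>i\<in>{..<N} - {n}.
      (real (lam n) + real (lam i) + 1) / \<bar>real (lam n) - real (lam i)\<bar>)"
    have "\<bar>p\<bar> * q = (\<Prod>i\<in>{..<N} - {n}. 1)"
      unfolding p_def q_def abs_prod prod.distrib[symmetric]
      using inj by (intro prod.cong) (auto simp: blaschke_factor_def inj_eq)
    then have "(\<bar>p\<bar> * q)\<^sup>2 = 1" by simp
    then have pq: "p\<^sup>2 * q\<^sup>2 = 1" by (simp add: power_mult_distrib)
    have q: "0 \<le> q" "q \<le> R ^ lam n" unfolding q_def by (intro prod_nonneg) (auto intro: R)
    have "(cmod (a n))\<^sup>2 * p\<^sup>2 \<le> (2 * real (lam n) + 1) * P\<^sup>2"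
      unfolding P_def p_def L2_norm_muentz_poly using n by (intro coeff_le_cauchy_form) auto
    then have "(cmod (a n))\<^sup>2 * p\<^sup>2 * q\<^sup>2 \<le> (2 * real (lam n) + 1) * P\<^sup>2 * q\<^sup>2"
      by (rule mult_right_mono) auto
    then have "(cmod (a n))\<^sup>2 \<le> (2 * real (lam n) + 1) * P\<^sup>2 * q\<^sup>2"
      by (simp add: mult.assoc pq)
    also have "\<dots> \<le> (3 ^ lam n)\<^sup>2 * P\<^sup>2 * (R ^ lam n)\<^sup>2"
    proof (intro mult_mono power_mono q)
      \<comment> \<open>Bernoulli's inequality absorbs the linear factor into the exponential one;
        squaring the power prepares the square root taken at the end.\<close>
      have "2 * real (lam n) + 1 \<le> 3 ^ lam n"
        using Bernoulli_inequality[of "2::real" "lam n"] by simp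
      also have "\<dots> \<le> (3 ^ lam n)\<^sup>2" by (intro self_le_power) auto
      finally show "2 * real (lam n) + 1 \<le> (3 ^ lam n)\<^sup>2" .
    qed (use P in auto)
    also have "\<dots> = ((3 * R) ^ lam n * P)\<^sup>2" by (simp add: power_mult_distrib mult_ac)
    finally show ?thesis
      unfolding P_def[symmetric] by (rule power2_le_imp_le) (use R(1) P in simp)
  qed
  moreover have "3 * R \<ge> 1" using R(1) by simp
  ultimately show ?thesis using that by blast
qed

section \<open>Muentz series with square summable coefficients\<close>

lemma integrable_power_series_lam:
  "integrable I01 (\<lambda>t. \<Sum>n. t ^ (2 * lam n))"
proof (rule integrable_suminf)
  show "integrable I01 (\<lambda>t. t ^ (2 * lam n))" for n by (rule integrable_I01_power)
  show "AE t in I01. summable (\<lambda>n. norm (t ^ (2 * lam n)))"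
    by (rule AE_I2)
       (auto simp: space_restrict_space power_mult power_less_one_iff abs_square_less_1
         intro!: summable_power_lam)
  \<comment> \<open>These integrals are at most 1 / \<open>lam n\<close>; here the convergence of
    the reciprocal sum enters.\<close>
  have "(LINT t|I01. norm (t ^ (2 * lam n))) = 1 / real (Suc (2 * lam n))" for n
    using integral_I01_power[of "2 * lam n"] by (simp add: power_mult)
  then show "summable (\<lambda>n. LINT t|I01. norm (t ^ (2 * lam n)))"
    using pos by (auto intro!: summable_comparison_test'[OF summable_inverse, of 0] frac_le)
qed

lemma muentz_series_L2:
  assumes d: "summable (\<lambda>n. (cmod (d n))\<^sup>2)"
    and f: "\<And>t. 0 < t \<Longrightarrow> t < 1 \<Longrightarrow> (\<lambda>n. d n * of_real t ^ lam n) sums f t"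
  shows "f \<in> L2_space"
    and "(\<lambda>N. L2_norm (\<lambda>t. f t - (\<Sum>n<N. d n * muentz_system lam n t))) \<longlonglongrightarrow> 0"
proof -
  define P where "P N = (\<lambda>t. \<Sum>n<N. d n * muentz_system lam n t)" for N
  \<comment> \<open>The pointwise Cauchy-Schwarz majorant of all finite pieces of the series, used
    for dominated convergence.\<close>
  define D where "D t = (\<Sum>n. (cmod (d n))\<^sup>2) * (\<Sum>n. t ^ (2 * lam n))" for t :: real
  have D: "integrable I01 D"
    unfolding D_def by (intro integrable_mult_right integrable_power_series_lam)
  have lim: "(\<lambda>N. P N t) \<longlonglongrightarrow> f t" if "t \<in> {0<..<1}" for t
    using f[of t] that by (simp add: sums_def P_def muentz_system_def)
  have fin: "(cmod (\<Sum>n\<in>A. d n * muentz_system lam n t))\<^sup>2 \<le> D t"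
    if t: "t \<in> {0<..<1}" and A: "finite A" for A t
  proof -
    have s: "summable (\<lambda>n. t ^ (2 * lam n))"
      unfolding power_mult using t by (intro summable_power_lam) (auto simp: power_less_one_iff)
    have "(cmod (\<Sum>n\<in>A. d n * muentz_system lam n t))\<^sup>2 \<le> (\<Sum>n\<in>A. cmod (d n) * t ^ lam n)\<^sup>2"
      using t by (intro power_mono order_trans[OF norm_sum] sum_mono)
        (auto simp: muentz_system_def norm_mult norm_power)
    also have "\<dots> \<le> (\<Sum>n\<in>A. (cmod (d n))\<^sup>2) * (\<Sum>n\<in>A. (t ^ lam n)\<^sup>2)"
      by (rule Cauchy_Schwarz_ineq_sum)
    also have "\<dots> = (\<Sum>n\<in>A. (cmod (d n))\<^sup>2) * (\<Sum>n\<in>A. t ^ (2 * lam n))"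
      by (simp add: mult.commute flip: power_mult)
    also have "\<dots> \<le> D t"
      unfolding D_def using t A s d
      by (intro mult_mono sum_le_suminf sum_nonneg suminf_nonneg) auto
    finally show ?thesis .
  qed
  \<comment> \<open>The tail is the limit of the finite blocks \<open>P M t - P N t\<close>, each of
    which is bounded by \<open>D t\<close>.\<close>
  have dom: "(cmod (f t - P N t))\<^sup>2 \<le> D t" if t: "t \<in> {0<..<1}" for t N
  proof (rule tendsto_upperbound)
    show "(\<lambda>M. (cmod (P M t - P N t))\<^sup>2) \<longlonglongrightarrow> (cmod (f t - P N t))\<^sup>2"
      by (intro tendsto_intros lim t)
    have "(cmod (P M t - P N t))\<^sup>2 \<le> D t" if "N \<le> M" for M
    proof -
      have "P M t - P N t = (\<Sum>n\<in>{..<M} - {..<N}. d n * muentz_system lam n t)"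
        unfolding P_def using that by (subst sum_diff) auto
      then show ?thesis using fin[OF t, of "{..<M} - {..<N}"] by simp
    qed
    then show "\<forall>\<^sub>F M in sequentially. (cmod (P M t - P N t))\<^sup>2 \<le> D t"
      by (rule eventually_sequentiallyI)
  qed simp
  have Pm: "P N \<in> borel_measurable I01" for N
    unfolding P_def by (rule L2_spaceD(1)[OF muentz_poly_L2])
  have fm [measurable]: "f \<in> borel_measurable I01"
    by (rule borel_measurable_LIMSEQ_metric[OF Pm]) (use lim in \<open>simp add: space_restrict_space\<close>)
  \<comment> \<open>The tail bound with N = 0, where \<open>P 0\<close> is the zero function, gives
    the majorant \<open>D\<close> for \<open>f\<close> itself.\<close>
  have "integrable I01 (\<lambda>t. (cmod (f t))\<^sup>2)"
    by (rule Bochner_Integration.integrable_bound[OF D])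
       (use dom[of _ 0] in \<open>fastforce simp: P_def space_restrict_space intro!: AE_I2\<close>)+
  then show "f \<in> L2_space" using fm by (simp add: L2_space_def)
  have "(\<lambda>N. LINT t|I01. (cmod (f t - P N t))\<^sup>2) \<longlonglongrightarrow> (LINT t|I01. 0)"
  proof (rule integral_dominated_convergence[OF _ _ D])
    show "(\<lambda>t. (cmod (f t - P N t))\<^sup>2) \<in> borel_measurable I01" for N
      using Pm[of N] by measurable
    show "AE t in I01. (\<lambda>N. (cmod (f t - P N t))\<^sup>2) \<longlonglongrightarrow> 0"
    proof (rule AE_I2)
      fix t assume "t \<in> space I01"
      then have "(\<lambda>N. (cmod (f t - P N t))\<^sup>2) \<longlonglongrightarrow> (cmod (f t - f t))\<^sup>2"
        by (intro tendsto_intros lim) (simp add: space_restrict_space)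
      then show "(\<lambda>N. (cmod (f t - P N t))\<^sup>2) \<longlonglongrightarrow> 0" by simp
    qed
    show "AE t in I01. norm ((cmod (f t - P N t))\<^sup>2) \<le> D t" for N
      using dom by (intro AE_I2) (simp add: space_restrict_space)
  qed simp
  then have "(\<lambda>N. sqrt (LINT t|I01. (cmod (f t - P N t))\<^sup>2)) \<longlonglongrightarrow> sqrt 0"
    by (intro tendsto_intros) simp
  then show "(\<lambda>N. L2_norm (\<lambda>t. f t - (\<Sum>n<N. d n * muentz_system lam n t))) \<longlonglongrightarrow> 0"
    by (simp add: L2_norm_def P_def)
qed

lemma muentz_series_in_closure:
  assumes "summable (\<lambda>n. (cmod (d n))\<^sup>2)"
    and "\<And>t. 0 < t \<Longrightarrow> t < 1 \<Longrightarrow> (\<lambda>n. d n * of_real t ^ lam n) sums f t"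
  shows "f \<in> muentz_closure lam"
  unfolding muentz_closure_def L2_closed_span_def
proof (intro CollectI conjI allI impI)
  note * = muentz_series_L2[OF assms]
  show "f \<in> L2_space" by (rule *)
  fix \<epsilon> :: real assume "\<epsilon> > 0"
  then have "\<forall>\<^sub>F N in sequentially. L2_norm (\<lambda>t. f t - (\<Sum>n<N. d n * muentz_system lam n t)) < \<epsilon>"
    using order_tendstoD(2)[OF *(2)] by blast
  then show "\<exists>N a. L2_norm (\<lambda>t. f t - (\<Sum>n<N. a n * muentz_system lam n t)) < \<epsilon>"
    by (auto simp: eventually_sequentially)
qed

text \<open>The partial sums converge in L2(0,1), and their pairing with \<open>r m\<close> is
  constantly \<open>d m\<close> as soon as they contain the term with index m.\<close>

lemma muentz_series_coeff:
  assumes r: "biorthogonal_family lam r"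
    and d: "summable (\<lambda>n. (cmod (d n))\<^sup>2)"
    and f: "\<And>t. 0 < t \<Longrightarrow> t < 1 \<Longrightarrow> (\<lambda>n. d n * of_real t ^ lam n) sums f t"
  shows "L2_inner f (r m) = d m"
proof (rule LIMSEQ_unique)
  show "(\<lambda>N. L2_inner (\<lambda>t. \<Sum>n<N. d n * muentz_system lam n t) (r m)) \<longlonglongrightarrow> L2_inner f (r m)"
    by (rule L2_inner_tendsto[OF muentz_poly_L2 _ biorthogonal_L2[OF r]])
       (rule muentz_series_L2[OF d f]; assumption)+
  show "(\<lambda>N. L2_inner (\<lambda>t. \<Sum>n<N. d n * muentz_system lam n t) (r m)) \<longlonglongrightarrow> d m"
    unfolding L2_inner_muentz_poly[OF r]
    by (rule tendsto_eventually, rule eventually_sequentiallyI[of "Suc m"]) simp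
qed

section \<open>Elements of the closed span as power series near the origin\<close>

lemma muentz_closure_approx:
  assumes r: "biorthogonal_family lam r" and g: "g \<in> muentz_closure lam"
  obtains N :: "nat \<Rightarrow> nat" and a :: "nat \<Rightarrow> nat \<Rightarrow> complex" and K R :: real where
    "(\<lambda>j. L2_norm (\<lambda>t. g t - (\<Sum>n<N j. a j n * muentz_system lam n t))) \<longlonglongrightarrow> 0"
    "\<forall>n. (\<lambda>j. if n < N j then a j n else 0) \<longlonglongrightarrow> L2_inner g (r n)"
    "\<forall>j. \<forall>n<N j. cmod (a j n) \<le> K * R ^ lam n" "R \<ge> 1" "K \<ge> 0"
proof -
  have gL: "g \<in> L2_space" using g by (simp add: muentz_closure_def L2_closed_span_def)
  have "\<exists>N a. L2_norm (\<lambda>t. g t - (\<Sum>n<N. a n * muentz_system lam n t)) < inverse (real (Suc j))" for j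
    using g by (simp add: muentz_closure_def L2_closed_span_def del: of_nat_Suc)
  then obtain N a where Na: "\<And>j. L2_norm (\<lambda>t. g t - (\<Sum>n<N j. a j n * muentz_system lam n t))
      < inverse (real (Suc j))"
    by metis
  define P where "P j = (\<lambda>t. \<Sum>n<N j. a j n * muentz_system lam n t)" for j
  have PL: "P j \<in> L2_space" for j
    unfolding P_def by (rule muentz_poly_L2)
  have lim: "(\<lambda>j. L2_norm (\<lambda>t. g t - P j t)) \<longlonglongrightarrow> 0"
    by (rule Lim_null_comparison[OF _ LIMSEQ_inverse_real_of_nat])
       (use Na in \<open>auto simp: P_def less_imp_le simp del: of_nat_Suc\<close>)
  obtain R where R: "R \<ge> 1" "\<And>N a n. n < N \<Longrightarrow>
      cmod (a n) \<le> R ^ lam n * L2_norm (\<lambda>t. \<Sum>k<N. a k * muentz_system lam k t)"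
    using muentz_poly_bound by blast
  \<comment> \<open>A common bound for the norms of the approximants: \<open>P j\<close> is
    \<open>g\<close> minus an error of norm at most 1.\<close>
  define K where "K = sqrt (2 * (L2_norm g)\<^sup>2 + 2)"
  have PK: "L2_norm (P j) \<le> K" for j
  proof -
    have "L2_norm (\<lambda>t. g t - P j t) \<le> 1"
      using Na[of j] le_imp_inverse_le[of 1 "real (Suc j)"] unfolding P_def by simp
    then have "(L2_norm (\<lambda>t. g t - P j t))\<^sup>2 \<le> 1" by (simp add: power_le_one)
    moreover have "(L2_norm (P j))\<^sup>2 \<le> 2 * (L2_norm g)\<^sup>2 + 2 * (L2_norm (\<lambda>t. g t - P j t))\<^sup>2"
      using L2_space_diff(2)[OF gL L2_space_diff(1)[OF gL PL[of j]]] by simp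
    ultimately show ?thesis unfolding K_def by (intro real_le_rsqrt) simp
  qed
  show ?thesis
  proof (rule that)
    show "(\<lambda>j. L2_norm (\<lambda>t. g t - (\<Sum>n<N j. a j n * muentz_system lam n t))) \<longlonglongrightarrow> 0"
      using lim by (simp add: P_def)
    \<comment> \<open>The value 0 stands for a coefficient that the j-th polynomial is too short to
      have.\<close>
    show "\<forall>n. (\<lambda>j. if n < N j then a j n else 0) \<longlonglongrightarrow> L2_inner g (r n)"
      using L2_inner_tendsto[OF PL gL biorthogonal_L2[OF r] lim]
      by (simp add: P_def L2_inner_muentz_poly[OF r])
    show "\<forall>j. \<forall>n<N j. cmod (a j n) \<le> K * R ^ lam n"
    proof (intro allI impI)
      fix j n assume "n < N j"
      have "cmod (a j n) \<le> R ^ lam n * L2_norm (P j)"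
        unfolding P_def using \<open>n < N j\<close> by (rule R(2))
      also have "\<dots> \<le> R ^ lam n * K" using R(1) by (intro mult_left_mono PK) auto
      finally show "cmod (a j n) \<le> K * R ^ lam n" by (simp add: mult.commute)
    qed
    show "R \<ge> 1" by (rule R(1))
    show "K \<ge> 0" by (simp add: K_def)
  qed
qed

text \<open>A crude form of the Clarkson-Erdos theorem: the series is only shown to converge to
  the given element near the origin.\<close>

lemma muentz_closure_AE_series:
  assumes r: "biorthogonal_family lam r" and g: "g \<in> muentz_closure lam"
  obtains \<delta> K R where "\<delta> > 0" "\<delta> \<le> 1" "\<delta> * R \<le> 1" "R \<ge> 1"
    "\<forall>n. cmod (L2_inner g (r n)) \<le> K * R ^ lam n"
    "AE t in I01. t < \<delta> \<longrightarrow> g t = (\<Sum>n. L2_inner g (r n) * of_real t ^ lam n)"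
proof -
  have gL: "g \<in> L2_space" using g by (simp add: muentz_closure_def L2_closed_span_def)
  define c where "c n = L2_inner g (r n)" for n
  obtain N :: "nat \<Rightarrow> nat" and a :: "nat \<Rightarrow> nat \<Rightarrow> complex" and K R :: real where
    lim: "(\<lambda>j. L2_norm (\<lambda>t. g t - (\<Sum>n<N j. a j n * muentz_system lam n t))) \<longlonglongrightarrow> 0"
    and coeff: "\<forall>n. (\<lambda>j. if n < N j then a j n else 0) \<longlonglongrightarrow> c n"
    and bound: "\<forall>j. \<forall>n<N j. cmod (a j n) \<le> K * R ^ lam n" and R: "R \<ge> 1" and K: "K \<ge> 0"
    by (rule muentz_closure_approx[OF r g, folded c_def]) (rule that)
  define b where "b j n = (if n < N j then a j n else 0)" for j n
  define P where "P j = (\<lambda>t. \<Sum>n<N j. a j n * muentz_system lam n t)" for j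
  have b: "cmod (b j n) \<le> K * R ^ lam n" for j n
    unfolding b_def using bound K R by auto
  \<comment> \<open>The uniform bound on the coefficients passes to their limits.\<close>
  have c: "cmod (c n) \<le> K * R ^ lam n" for n
    by (rule tendsto_upperbound[OF tendsto_norm[OF coeff[rule_format, of n]]])
       (use b in \<open>auto simp: b_def intro!: always_eventually\<close>)
  have PL: "P j \<in> L2_space" for j
    unfolding P_def by (rule muentz_poly_L2)
  \<comment> \<open>For t < 1/R the terms are dominated by \<open>K * (R * t) ^ lam n\<close>,
    summable and independent of j, so Tannery's theorem allows the limit to be taken
    termwise.\<close>
  have conv: "(\<lambda>j. P j t) \<longlonglongrightarrow> (\<Sum>n. c n * of_real t ^ lam n)" if t: "0 < t" "t < 1 / R" for t
  proof -
    have "0 \<le> R * t" "R * t < 1" using t R by (auto simp: field_simps)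
    then have s: "summable (\<lambda>n. K * (R * t) ^ lam n)"
      by (intro summable_mult summable_power_lam)
    have "(\<lambda>j. \<Sum>n. b j n * of_real t ^ lam n) \<longlonglongrightarrow> (\<Sum>n. c n * of_real t ^ lam n)"
    proof (rule tannerys_theorem[THEN conjunct2, THEN conjunct2, OF _ _ s])
      show "(\<lambda>j. b j n * of_real t ^ lam n) \<longlonglongrightarrow> c n * of_real t ^ lam n" for n
        unfolding b_def by (intro tendsto_intros coeff[rule_format])
      have "norm (b j n * of_real t ^ lam n) \<le> K * (R * t) ^ lam n" for j n
        using b[of j n] t
        by (simp add: norm_mult norm_power power_mult_distrib mult_right_mono flip: mult.assoc)
      then show "\<forall>\<^sub>F (n, j) in at_top \<times>\<^sub>F sequentially.
          norm (b j n * of_real t ^ lam n) \<le> K * (R * t) ^ lam n"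
        by (intro always_eventually) auto
    qed simp
    moreover have "(\<Sum>n. b j n * of_real t ^ lam n) = P j t" for j
      unfolding P_def muentz_system_def b_def
      by (subst suminf_finite[of "{..<N j}"]) auto
    ultimately show ?thesis by simp
  qed
  have "(\<lambda>j. (L2_norm (\<lambda>t. g t - P j t))\<^sup>2) \<longlonglongrightarrow> 0\<^sup>2"
    using lim unfolding P_def by (intro tendsto_power)
  then have "(\<lambda>j. LINT t|I01. norm ((cmod (g t - P j t))\<^sup>2)) \<longlonglongrightarrow> 0"
    by (simp add: L2_norm_power2)
  \<comment> \<open>Convergence in L2 is L1 convergence of the squared errors, so a subsequence
    converges almost everywhere and its limit can be compared with the series.\<close>
  then obtain s where s: "strict_mono s" "AE t in I01. (\<lambda>j. (cmod (g t - P (s j) t))\<^sup>2) \<longlonglongrightarrow> 0"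
    using tendsto_L1_AE_subseq[of I01 "\<lambda>j t. (cmod (g t - P j t))\<^sup>2"]
      L2_spaceD(2)[OF L2_space_diff(1)[OF gL PL]] by blast
  have "AE t in I01. t \<in> {0<..<1}"
    by (rule AE_I2) (simp add: space_restrict_space)
  with s(2) have ae: "AE t in I01. t < 1 / R \<longrightarrow> g t = (\<Sum>n. c n * of_real t ^ lam n)"
  proof eventually_elim
    case (elim t)
    show ?case
    proof
      assume t: "t < 1 / R"
      have "(\<lambda>j. P (s j) t) \<longlonglongrightarrow> (\<Sum>n. c n * of_real t ^ lam n)"
        using LIMSEQ_subseq_LIMSEQ[OF conv[of t] s(1)] elim t by (simp add: o_def)
      then have "(\<lambda>j. (cmod (g t - P (s j) t))\<^sup>2) \<longlonglongrightarrow>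
          (cmod (g t - (\<Sum>n. c n * of_real t ^ lam n)))\<^sup>2"
        by (intro tendsto_intros)
      with elim(1) have "(cmod (g t - (\<Sum>n. c n * of_real t ^ lam n)))\<^sup>2 = 0"
        using LIMSEQ_unique by blast
      then show "g t = (\<Sum>n. c n * of_real t ^ lam n)" by simp
    qed
  qed
  show ?thesis
    by (rule that[of "1 / R" R K]) (use R ae c in \<open>auto simp: c_def\<close>)
qed

text \<open>Near 0 the function \<open>F\<close> and the series with coefficients \<open>c n\<close>
  are both holomorphic and agree at almost every small positive t. By the identity theorem they
  agree on a disc, so the Taylor coefficients are those of the series.\<close>

lemma muentz_disc_taylor:
  assumes r: "biorthogonal_family lam r" and F: "F \<in> muentz_disc lam"
  shows "taylor_coeff F (lam n) = L2_inner (\<lambda>t. F (complex_of_real t)) (r n)"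
    and "m \<notin> range lam \<Longrightarrow> taylor_coeff F m = 0"
proof -
  have inj: "inj lam" using mono by (rule strict_mono_imp_inj_on)
  obtain g where hol: "F holomorphic_on ball 0 1" and g: "g \<in> muentz_closure lam"
    and Fg: "AE t in I01. F (of_real t) = g t"
    using F by (auto simp: muentz_disc_def)
  have gL: "g \<in> L2_space" using g by (simp add: muentz_closure_def L2_closed_span_def)
  define c where "c n = L2_inner g (r n)" for n
  have "continuous_on {0<..<1} (\<lambda>t. F (of_real t))"
    by (intro continuous_on_compose2[OF holomorphic_on_imp_continuous_on[OF hol]]
        continuous_intros) auto
  then have Fm: "(\<lambda>t. F (of_real t)) \<in> borel_measurable I01"
    by (intro continuous_imp_measurable_on_sets_lebesgue) auto
  \<comment> \<open>Passing from \<open>F\<close> to the representative \<open>g\<close> changes the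
    integrand on a null set only.\<close>
  have cF: "L2_inner (\<lambda>t. F (of_real t)) (r n) = c n" for n
    unfolding L2_inner_def c_def
  proof (rule integral_cong_AE)
    have "cnj \<in> borel_measurable borel"
      by (intro borel_measurable_continuous_onI continuous_intros)
    from measurable_compose[OF L2_spaceD(1)[OF biorthogonal_L2[OF r]] this]
    have [measurable]: "(\<lambda>t. cnj (r n t)) \<in> borel_measurable I01" .
    note [measurable] = Fm L2_spaceD(1)[OF gL]
    show "(\<lambda>t. F (of_real t) * cnj (r n t)) \<in> borel_measurable I01"
      and "(\<lambda>t. g t * cnj (r n t)) \<in> borel_measurable I01" by measurable
    show "AE t in I01. F (of_real t) * cnj (r n t) = g t * cnj (r n t)"
      using Fg by eventually_elim simp
  qed
  obtain \<delta> K R where \<delta>: "\<delta> > 0" "\<delta> \<le> 1" "\<delta> * R \<le> 1" and R: "R \<ge> 1"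
    and cb: "\<forall>n. cmod (c n) \<le> K * R ^ lam n"
    and ae: "AE t in I01. t < \<delta> \<longrightarrow> g t = (\<Sum>n. c n * of_real t ^ lam n)"
    by (rule muentz_closure_AE_series[OF r g, folded c_def]) (rule that)
  \<comment> \<open>The sparse coefficients spread over all exponents, with 0 off the range of
    \<open>lam\<close>, to form an ordinary power series.\<close>
  define B where "B m = (if m \<in> range lam then c (inv lam m) else 0)" for m
  have Bl: "B (lam n) = c n" for n using inj by (simp add: B_def)
  define G where "G z = (\<Sum>n. c n * z ^ lam n)" for z :: complex
  have G: "(\<lambda>m. B m * z ^ m) sums G z" if z: "z \<in> ball 0 \<delta>" for z
  proof -
    have "R * cmod z < R * \<delta>" using z R by simp
    then have "R * cmod z < 1" using \<delta> by (simp add: mult.commute)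
    then have "summable (\<lambda>n. K * (R * cmod z) ^ lam n)"
      using R by (intro summable_mult summable_power_lam) auto
    then have "summable (\<lambda>n. c n * z ^ lam n)"
    proof (rule summable_comparison_test'[where N = 0])
      show "norm (c n * z ^ lam n) \<le> K * (R * cmod z) ^ lam n" for n
        using cb[rule_format, of n]
        by (simp add: norm_mult norm_power power_mult_distrib mult_right_mono flip: mult.assoc)
    qed
    then have "(\<lambda>n. B (lam n) * z ^ lam n) sums G z"
      unfolding G_def Bl by (rule summable_sums)
    then show ?thesis
      by (subst (asm) sums_mono_reindex[OF mono]) (auto simp: B_def)
  qed
  have Ghol: "G holomorphic_on ball 0 \<delta>"
    by (rule power_series_holomorphic[where a = B]) (use G in simp)
  define U where "U = complex_of_real ` {t. 0 < t \<and> t < \<delta> \<and> F (of_real t) = G (of_real t)}"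
  have islim: "0 islimpt U"
    unfolding islimpt_approachable
  \<comment> \<open>Almost everywhere equality supplies a point of \<open>U\<close> below any given
    positive bound.\<close>
  proof (intro allI impI)
    fix e :: real assume "e > 0"
    have "AE t in I01. t < \<delta> \<longrightarrow> F (of_real t) = G (of_real t)"
      using Fg ae by eventually_elim (simp add: G_def)
    then obtain t where "0 < t" "t < min e \<delta>" "t < \<delta> \<longrightarrow> F (of_real t) = G (of_real t)"
      by (rule AE_I01_imp_ex[where \<epsilon> = "min e \<delta>"]) (use \<open>e > 0\<close> \<delta> in auto)
    then show "\<exists>x'\<in>U. x' \<noteq> 0 \<and> dist x' 0 < e"
      by (intro bexI[of _ "of_real t"]) (auto simp: U_def)
  qed
  have FG: "F z - G z = 0" if "z \<in> ball 0 \<delta>" for z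
  proof (rule analytic_continuation[where f = "\<lambda>z. F z - G z" and S = "ball 0 \<delta>", OF _ _ _ _ _ islim])
    show "(\<lambda>z. F z - G z) holomorphic_on ball 0 \<delta>"
      using \<delta> by (intro holomorphic_intros Ghol holomorphic_on_subset[OF hol]) auto
    show "U \<subseteq> ball 0 \<delta>" by (auto simp: U_def)
    show "F z - G z = 0" if "z \<in> U" for z using that by (auto simp: U_def)
  qed (use that \<delta> in auto)
  have "\<forall>\<^sub>F z in nhds 0. z \<in> ball 0 \<delta>"
    using \<delta> by (intro eventually_nhds_in_open) auto
  then have "\<forall>\<^sub>F z in nhds 0. (\<lambda>m. B m * z ^ m) sums F z"
    by eventually_elim (use G FG in force)
  then have "taylor_coeff F = B" by (rule taylor_coeff_unique)
  then show "taylor_coeff F (lam n) = L2_inner (\<lambda>t. F (complex_of_real t)) (r n)"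
    by (simp only: Bl cF)
  show "m \<notin> range lam \<Longrightarrow> taylor_coeff F m = 0"
    using \<open>taylor_coeff F = B\<close> by (simp add: B_def)
qed

section \<open>Hardy functions with spectrum in the given sequence\<close>

lemma hardy2_spectrum_series:
  assumes f: "f \<in> hardy2_spectrum lam"
  shows "summable (\<lambda>n. (cmod (taylor_coeff f (lam n)))\<^sup>2)"
    and "(\<lambda>n. (cmod (taylor_coeff f (lam n)))\<^sup>2) sums (hardy2_norm f)\<^sup>2"
    and "z \<in> ball 0 1 \<Longrightarrow> (\<lambda>n. taylor_coeff f (lam n) * z ^ lam n) sums f z"
proof -
  have hol: "f holomorphic_on ball 0 1" and s: "summable (\<lambda>n. (cmod (taylor_coeff f n))\<^sup>2)"
    and 0: "\<And>n. n \<notin> range lam \<Longrightarrow> taylor_coeff f n = 0"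
    using f by (auto simp: hardy2_spectrum_def hardy2_iff)
  have "(hardy2_norm f)\<^sup>2 = (\<Sum>n. (cmod (taylor_coeff f n))\<^sup>2)"
    unfolding hardy2_norm_def using s by (simp add: suminf_nonneg)
  with s have "(\<lambda>n. (cmod (taylor_coeff f n))\<^sup>2) sums (hardy2_norm f)\<^sup>2"
    by (simp add: summable_sums)
  then show "(\<lambda>n. (cmod (taylor_coeff f (lam n)))\<^sup>2) sums (hardy2_norm f)\<^sup>2"
    by (subst sums_mono_reindex[OF mono]) (auto simp: 0)
  then show "summable (\<lambda>n. (cmod (taylor_coeff f (lam n)))\<^sup>2)" by (rule sums_summable)
  show "(\<lambda>n. taylor_coeff f (lam n) * z ^ lam n) sums f z" if "z \<in> ball 0 1"
    using taylor_coeff_sums[OF hol that]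
    by (subst sums_mono_reindex[OF mono, of "\<lambda>n. taylor_coeff f n * z ^ n"]) (auto simp: 0)
qed

lemma hardy2_spectrum_ray_series:
  assumes "f \<in> hardy2_spectrum lam" "0 < t" "t < 1"
  shows "(\<lambda>n. taylor_coeff f (lam n) * cis \<theta> ^ lam n * of_real t ^ lam n) sums f (of_real t * cis \<theta>)"
  using hardy2_spectrum_series(3)[OF assms(1), of "of_real t * cis \<theta>"] assms(2,3)
  by (simp add: norm_mult power_mult_distrib mult_ac)

text \<open>On the ray of angle \<theta> the function is again a Muentz series in t: the rotation
  only multiplies the coefficients by unimodular numbers, which preserves square
  summability.\<close>

lemma hardy2_spectrum_ray:
  assumes r: "biorthogonal_family lam r" and f: "f \<in> hardy2_spectrum lam"
  shows "(\<lambda>t. f (of_real t * cis \<theta>)) \<in> muentz_closure lam"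
    and "L2_inner (\<lambda>t. f (of_real t * cis \<theta>)) (r n) = taylor_coeff f (lam n) * cis \<theta> ^ lam n"
proof -
  have s: "summable (\<lambda>n. (cmod (taylor_coeff f (lam n) * cis \<theta> ^ lam n))\<^sup>2)"
    using hardy2_spectrum_series(1)[OF f] by (simp add: norm_mult norm_power)
  note * = s hardy2_spectrum_ray_series[OF f]
  show "(\<lambda>t. f (of_real t * cis \<theta>)) \<in> muentz_closure lam"
    by (rule muentz_series_in_closure[OF *])
  show "L2_inner (\<lambda>t. f (of_real t * cis \<theta>)) (r n) = taylor_coeff f (lam n) * cis \<theta> ^ lam n"
    by (rule muentz_series_coeff[OF r *])
qed

text \<open>One inclusion is the ray statement at angle 0, the other the identification of Taylor
  coefficients with pairings, which turns one summability condition into the other.\<close>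

lemma hardy2_spectrum_eq_muentz_disc_l2:
  assumes r: "biorthogonal_family lam r"
  shows "hardy2_spectrum lam = muentz_disc_l2 lam r"
proof (intro set_eqI iffI)
  fix f assume f: "f \<in> hardy2_spectrum lam"
  then have "f holomorphic_on ball 0 1" by (simp add: hardy2_spectrum_def hardy2_def)
  moreover have "(\<lambda>t. f (of_real t)) \<in> muentz_closure lam"
    using hardy2_spectrum_ray(1)[OF r f, of 0] by simp
  ultimately have "f \<in> muentz_disc lam"
    unfolding muentz_disc_def by (auto intro!: bexI[of _ "\<lambda>t. f (of_real t)"])
  moreover have "L2_inner (\<lambda>t. f (of_real t)) (r n) = taylor_coeff f (lam n)" for n
    using hardy2_spectrum_ray(2)[OF r f, of 0] by simp
  ultimately show "f \<in> muentz_disc_l2 lam r"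
    using hardy2_spectrum_series(1)[OF f] by (simp add: muentz_disc_l2_def)
next
  fix F assume "F \<in> muentz_disc_l2 lam r"
  then have F: "F \<in> muentz_disc lam"
    and s: "summable (\<lambda>n. (cmod (L2_inner (\<lambda>t. F (complex_of_real t)) (r n)))\<^sup>2)"
    by (auto simp: muentz_disc_l2_def)
  note tc = muentz_disc_taylor[OF r F]
  have "summable (\<lambda>n. (cmod (taylor_coeff F (lam n)))\<^sup>2)" using s by (simp add: tc)
  then have "summable (\<lambda>n. (cmod (taylor_coeff F n))\<^sup>2)"
    by (subst (asm) summable_mono_reindex[OF mono]) (auto simp: tc)
  then show "F \<in> hardy2_spectrum lam"
    using F tc(2) by (simp add: hardy2_spectrum_def hardy2_iff muentz_disc_def)
qed

end

theorem theorem1p2: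
  fixes lam :: "nat \<Rightarrow> nat" and r :: "nat \<Rightarrow> real \<Rightarrow> complex"
  assumes "strict_mono lam"
    and "\<And>n. lam n > 0"
    and "summable (\<lambda>n. 1 / real (lam n))"
    and "biorthogonal_family lam r"
  shows "hardy2_spectrum lam = muentz_disc_l2 lam r \<and>
    (\<forall>f \<in> hardy2_spectrum lam.
       (\<lambda>n. (cmod (L2_inner (\<lambda>t. f (complex_of_real t)) (r n)))\<^sup>2) sums (hardy2_norm f)\<^sup>2) \<and>
    (\<forall>f \<in> hardy2_spectrum lam.
       (\<forall>z \<in> ball 0 1. (\<lambda>n. taylor_coeff f (lam n) * z ^ lam n) sums f z) \<and>
       (\<forall>\<theta> \<in> {0..2*pi}. \<forall>n.
          integrable (lebesgue_on {0<..<1})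
            (\<lambda>t. f (complex_of_real t * cis \<theta>) * cnj (r n t)) \<and>
          taylor_coeff f (lam n) =
            (LINT t|lebesgue_on {0<..<1}. f (complex_of_real t * cis \<theta>) * cnj (r n t)) *
            exp (- (\<i> * complex_of_real \<theta> * of_nat (lam n)))))"
proof -
  interpret muentz_sequence lam by unfold_locales (use assms in auto)
  note r = assms(4)
  show ?thesis
  proof (intro conjI ballI allI)
    show "hardy2_spectrum lam = muentz_disc_l2 lam r"
      by (rule hardy2_spectrum_eq_muentz_disc_l2[OF r])
  next
    fix f assume f: "f \<in> hardy2_spectrum lam"
    have "L2_inner (\<lambda>t. f (of_real t)) (r n) = taylor_coeff f (lam n)" for n
      using hardy2_spectrum_ray(2)[OF r f, of 0] by simp
    then show "(\<lambda>n. (cmod (L2_inner (\<lambda>t. f (complex_of_real t)) (r n)))\<^sup>2) sums (hardy2_norm f)\<^sup>2"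
      using hardy2_spectrum_series(2)[OF f] by simp
  next
    fix f and z :: complex assume "f \<in> hardy2_spectrum lam" "z \<in> ball 0 1"
    then show "(\<lambda>n. taylor_coeff f (lam n) * z ^ lam n) sums f z"
      by (rule hardy2_spectrum_series(3))
  next
    fix f \<theta> n assume f: "f \<in> hardy2_spectrum lam"
    note ray = hardy2_spectrum_ray[OF r f, of \<theta>]
    show "integrable (lebesgue_on {0<..<1}) (\<lambda>t. f (complex_of_real t * cis \<theta>) * cnj (r n t))"
      using ray(1) biorthogonal_L2[OF r]
      by (intro L2_mult_integrable(2)) (auto simp: muentz_closure_def L2_closed_span_def)
    \<comment> \<open>The exponential undoes the rotation of the coefficient along the ray.\<close>
    have "cis \<theta> ^ lam n * exp (- (\<i> * complex_of_real \<theta> * of_nat (lam n))) = 1"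
      unfolding Complex.DeMoivre unfolding cis_conv_exp exp_add[symmetric] by (simp add: mult_ac)
    then show "taylor_coeff f (lam n) =
        (LINT t|lebesgue_on {0<..<1}. f (complex_of_real t * cis \<theta>) * cnj (r n t)) *
        exp (- (\<i> * complex_of_real \<theta> * of_nat (lam n)))"
      using ray(2)[of n] by (simp add: L2_inner_def mult.assoc)
  qed
qed

end
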